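(* Consider finite subsets $\alpha\subseteq\widehat{\mathbb C}$ with $\mathcal A_\alpha\simeq\mathbb Z_n$, $n\ge2$, and with prescribed cyclic-$n$ component index. (a) Let $n\ge4$. Such $\alpha$ exists for index $(1,1)$, with $|\alpha|=1+n$; for index $(1,2)$, with $|\alpha|=1+2n$; and for every index $(\nu,k)\in\{0,1,2\}\times\mathbb N$ with $k\ge3$, with $|\alpha|=\nu+nk$. No such $\alpha$ exists for the indices $(0,1)$, $(0,2)$, $(2,1)$, $(2,2)$. (b) Let $n\in\{2,3\}$. Such $\alpha$ exists for index $(1,2)$, with $|\alpha|=1+2n$, and for every index $(\nu,k)\in\{0,1,2\}\times\mathbb N$ with $k\ge3$, with $|\alpha|=\nu+nk$. No such $\alpha$ exists for the indices $(0,1)$, $(0,2)$, $(1,1)$, $(2,1)$, $(2,2)$. Moreover, with $\alpha$ ranging over finite subsets of $\widehat{\mathbb C}$ and $k$ over integers, $$\{|\alpha| : \mathcal A_\alpha\simeq\mathbb Z_n\}=\{x+nk\mid x\in\{0,1,2\},\ k\ge3\}\cup\{1+n,1+2n\}\quad\text{for } n\ge4,$$ $$\{|\alpha| : \mathcal A_\alpha\simeq\mathbb Z_n\}=\{x+nk\mid x\in\{0,1,2\},\ k\ge3\}\cup\{1+2n\}\quad\text{for } n=2,3.$$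
   Context: $\mathbb N=\{0,1,2,\dots\}$, $\widehat{\mathbb C}=\mathbb C\cup\{\infty\}$, $\mathbb C^*=\mathbb C\setminus\{0\}$. For $\alpha\subseteq\widehat{\mathbb C}$, $\mathcal A_\alpha$ is the group of all Möbius transformations $f\in\mathrm{PSL}(2,\mathbb C)$ with $f(\alpha)=\alpha$. $\mathbb Z_n$ is the cyclic group of order $n$. Let $G=\langle z\mapsto e^{2\pi i/n}z\rangle\simeq\mathbb Z_n$. Its orbits are $\{\infty\}$, $\{0\}$ and $C_n(z)=\{e^{\frac{j}{n}2\pi i}z\mid j\in\mathbb Z\}$ for $z\in\mathbb C^*$. For a subset $\alpha\subseteq\widehat{\mathbb C}$ that is a finite union of $G$-orbits, its cyclic-$n$ component index is $(\nu,k)\in\{0,1,2\}\times\mathbb N$, where $\nu$ is the number of orbits among $\{\infty\},\{0\}$ and $k$ the number of orbits of type $C_n$ in $\alpha$. *)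

theory Defs
  imports "HOL-Analysis.Analysis" "HOL-Algebra.Elementary_Groups" "HOL-Algebra.Group_Action"
begin

section \<open>The Riemann sphere and its Moebius transformations\<close>

datatype riemann_sphere = Fin complex | Infty

fun sphere_moebius :: "complex \<Rightarrow> complex \<Rightarrow> complex \<Rightarrow> complex \<Rightarrow> riemann_sphere \<Rightarrow> riemann_sphere" where
  "sphere_moebius a b c d (Fin z) = (if c * z + d = 0 then Infty else Fin (moebius a b c d z))"
| "sphere_moebius a b c d Infty = (if c = 0 then Infty else Fin (a / c))"

text \<open>
  The elements of \<open>PSL(2,\<complex>)\<close> are taken as maps of the sphere, so that two matrices that
  differ by a scalar give the same element. Lemma \<open>carrier_moebius_group_SL\<close> below shows that
  normalising the determinant to \<open>1\<close> gives the same set of maps.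
\<close>

definition moebius_group :: "(riemann_sphere \<Rightarrow> riemann_sphere) monoid" where
  "moebius_group =
     \<lparr>carrier = {sphere_moebius a b c d | a b c d. a * d - b * c \<noteq> 0}, monoid.mult = (\<circ>), one = id\<rparr>"

definition set_aut_group :: "riemann_sphere set \<Rightarrow> (riemann_sphere \<Rightarrow> riemann_sphere) monoid" where
  "set_aut_group \<alpha> = moebius_group\<lparr>carrier := {f \<in> carrier moebius_group. f ` \<alpha> = \<alpha>}\<rparr>"

section \<open>The rotation group and the component index\<close>

definition rotation :: "nat \<Rightarrow> riemann_sphere \<Rightarrow> riemann_sphere" where
  "rotation n = sphere_moebius (exp (2 * of_real pi * \<i> / of_nat n)) 0 0 1"

definition rotation_group :: "nat \<Rightarrow> (riemann_sphere \<Rightarrow> riemann_sphere) monoid" where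
  "rotation_group n = subgroup_generated moebius_group {rotation n}"

definition rotation_orbits :: "nat \<Rightarrow> riemann_sphere set set" where
  "rotation_orbits n = orbits (rotation_group n) UNIV (\<lambda>f. f)"

definition cyclic_orbit :: "nat \<Rightarrow> complex \<Rightarrow> riemann_sphere set" where
  "cyclic_orbit n z = {Fin (exp (of_int j / of_nat n * (2 * of_real pi * \<i>)) * z) | j :: int. True}"

text \<open>
  The index \<open>(\<nu>, k)\<close> is a relation, because it is defined only for finite unions of orbits.
\<close>

definition has_cyclic_index :: "nat \<Rightarrow> riemann_sphere set \<Rightarrow> nat \<times> nat \<Rightarrow> bool" where
  "has_cyclic_index n \<alpha> i \<longleftrightarrow>
     (\<exists>\<O> \<subseteq> rotation_orbits n. finite \<O> \<and> \<alpha> = \<Union>\<O>) \<and>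
     fst i = card {B. B \<in> {{Infty}, {Fin 0}} \<and> B \<subseteq> \<alpha>} \<and>
     snd i = card {B. (\<exists>z. z \<noteq> 0 \<and> B = cyclic_orbit n z) \<and> B \<subseteq> \<alpha>}"

section \<open>Basic facts\<close>

lemma sphere_moebius_comp:
  assumes "a * d - b * c \<noteq> 0" "a' * d' - b' * c' \<noteq> 0"
  shows "sphere_moebius a b c d \<circ> sphere_moebius a' b' c' d' =
         sphere_moebius (a * a' + b * c') (a * b' + b * d') (c * a' + d * c') (c * b' + d * d')"
proof
  fix x
  show "(sphere_moebius a b c d \<circ> sphere_moebius a' b' c' d') x =
        sphere_moebius (a * a' + b * c') (a * b' + b * d') (c * a' + d * c') (c * b' + d * d') x"
  proof (cases x)
    case (Fin z)
    define p q where "p = a' * z + b'" and "q = c' * z + d'"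
    have pq: "(a * a' + b * c') * z + (a * b' + b * d') = a * p + b * q"
      "(c * a' + d * c') * z + (c * b' + d * d') = c * p + d * q"
      by (simp_all add: p_def q_def algebra_simps)
    show ?thesis
    proof (cases "q = 0")
      case True
      have "p \<noteq> 0"
      proof
        assume "p = 0"
        have "a' * q - c' * p = a' * d' - b' * c'" "d' * p - b' * q = (a' * d' - b' * c') * z"
          by (simp_all add: p_def q_def algebra_simps)
        with \<open>p = 0\<close> True assms show False by simp
      qed
      then show ?thesis using True pq Fin by (simp add: moebius_def flip: p_def q_def)
    next
      case False
      have "c * (p / q) + d = (c * p + d * q) / q" "a * (p / q) + b = (a * p + b * q) / q"
        using False by (simp_all add: field_simps)
      then show ?thesis using False pq Fin by (simp add: moebius_def flip: p_def q_def)
    qed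
  next
    case Infty
    show ?thesis
    proof (cases "c' = 0")
      case True
      then show ?thesis using assms Infty by auto
    next
      case False
      have "c * (a' / c') + d = (c * a' + d * c') / c'" "a * (a' / c') + b = (a * a' + b * c') / c'"
        using False by (simp_all add: field_simps)
      then show ?thesis using False Infty by (simp add: moebius_def)
    qed
  qed
qed

lemma sphere_moebius_id: "k \<noteq> 0 \<Longrightarrow> sphere_moebius k 0 0 k = id"
proof
  fix x assume "k \<noteq> 0"
  then show "sphere_moebius k 0 0 k x = id x" by (cases x) (auto simp: moebius_def)
qed

lemma sphere_moebius_scale: "k \<noteq> 0 \<Longrightarrow> sphere_moebius (k * a) (k * b) (k * c) (k * d) = sphere_moebius a b c d"
proof
  fix x assume k: "k \<noteq> 0"
  have "k * c * z + k * d = k * (c * z + d)" "k * a * z + k * b = k * (a * z + b)" for z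
    by (simp_all add: algebra_simps)
  then show "sphere_moebius (k * a) (k * b) (k * c) (k * d) x = sphere_moebius a b c d x"
    using k by (cases x) (auto simp: moebius_def)
qed

lemma mult_moebius_group [simp]: "f \<otimes>\<^bsub>moebius_group\<^esub> g = f \<circ> g"
  and one_moebius_group [simp]: "\<one>\<^bsub>moebius_group\<^esub> = id"
  by (simp_all add: moebius_group_def)

lemma sphere_moebius_in_carrier: "a * d - b * c \<noteq> 0 \<Longrightarrow> sphere_moebius a b c d \<in> carrier moebius_group"
  unfolding moebius_group_def by force

lemma carrier_moebius_group_SL:
  "carrier moebius_group = {sphere_moebius a b c d | a b c d. a * d - b * c = 1}"
proof (intro equalityI subsetI)
  fix f assume "f \<in> carrier moebius_group"
  then obtain a b c d where f: "f = sphere_moebius a b c d" and D: "a * d - b * c \<noteq> 0"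
    by (auto simp: moebius_group_def)
  define s where "s = inverse (csqrt (a * d - b * c))"
  have "s \<noteq> 0" using D by (simp add: s_def)
  have "s * a * (s * d) - s * b * (s * c) = s\<^sup>2 * (a * d - b * c)"
    by (simp add: power2_eq_square algebra_simps)
  also have "\<dots> = 1" using D by (simp add: s_def power_inverse)
  finally have "s * a * (s * d) - s * b * (s * c) = 1" .
  moreover have "f = sphere_moebius (s * a) (s * b) (s * c) (s * d)"
    using f sphere_moebius_scale[OF \<open>s \<noteq> 0\<close>, of a b c d] by simp
  ultimately show "f \<in> {sphere_moebius a b c d | a b c d. a * d - b * c = 1}"
    unfolding mem_Collect_eq by blast
qed (fastforce simp: moebius_group_def)

lemma group_moebius_group: "group moebius_group"
proof (rule groupI)
  fix f g assume "f \<in> carrier moebius_group" "g \<in> carrier moebius_group"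
  then obtain a b c d a' b' c' d' where fg: "f = sphere_moebius a b c d" "g = sphere_moebius a' b' c' d'"
    and D: "a * d - b * c \<noteq> 0" "a' * d' - b' * c' \<noteq> 0"
    by (auto simp: moebius_group_def)
  have "(a * a' + b * c') * (c * b' + d * d') - (a * b' + b * d') * (c * a' + d * c')
      = (a * d - b * c) * (a' * d' - b' * c')"
    by (simp add: algebra_simps)
  also have "\<dots> \<noteq> 0" using D by simp
  finally show "f \<otimes>\<^bsub>moebius_group\<^esub> g \<in> carrier moebius_group"
    using fg sphere_moebius_comp[OF D] by (auto simp: moebius_group_def)
next
  have "id = sphere_moebius 1 0 0 1" using sphere_moebius_id[of 1] by simp
  then show "\<one>\<^bsub>moebius_group\<^esub> \<in> carrier moebius_group"
    by (fastforce simp: moebius_group_def)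
next
  fix f assume "f \<in> carrier moebius_group"
  then obtain a b c d where f: "f = sphere_moebius a b c d" and D: "a * d - b * c \<noteq> 0"
    by (auto simp: moebius_group_def)
  have D': "d * a - (- b) * (- c) \<noteq> 0" using D by (simp add: mult.commute)
  have "sphere_moebius d (- b) (- c) a \<circ> f = sphere_moebius (a * d - b * c) 0 0 (a * d - b * c)"
    using sphere_moebius_comp[OF D' D] f by (simp add: mult.commute)
  then have "sphere_moebius d (- b) (- c) a \<circ> f = id" using sphere_moebius_id[OF D] by simp
  moreover have "sphere_moebius d (- b) (- c) a \<in> carrier moebius_group"
    using D' by (rule sphere_moebius_in_carrier)
  ultimately show "\<exists>g \<in> carrier moebius_group. g \<otimes>\<^bsub>moebius_group\<^esub> f = \<one>\<^bsub>moebius_group\<^esub>"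
    by auto
qed (auto simp: moebius_group_def)

lemma group_set_aut_group: "group (set_aut_group \<alpha>)"
proof -
  interpret group moebius_group by (rule group_moebius_group)
  have "subgroup {f \<in> carrier moebius_group. f ` \<alpha> = \<alpha>} moebius_group"
  proof (rule subgroupI)
    have "\<one>\<^bsub>moebius_group\<^esub> ` \<alpha> = \<alpha>" by (simp add: moebius_group_def)
    then show "{f \<in> carrier moebius_group. f ` \<alpha> = \<alpha>} \<noteq> {}"
      using one_closed by blast
  next
    fix f assume f: "f \<in> {f \<in> carrier moebius_group. f ` \<alpha> = \<alpha>}"
    let ?g = "inv\<^bsub>moebius_group\<^esub> f"
    have "?g \<circ> f = id" using f l_inv[of f] by (simp add: moebius_group_def)
    then have "?g ` (f ` \<alpha>) = \<alpha>" by (simp add: image_comp)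
    then show "?g \<in> {f \<in> carrier moebius_group. f ` \<alpha> = \<alpha>}" using f by simp
  next
    fix f g assume fg: "f \<in> {f \<in> carrier moebius_group. f ` \<alpha> = \<alpha>}"
      "g \<in> {f \<in> carrier moebius_group. f ` \<alpha> = \<alpha>}"
    then have "(f \<otimes>\<^bsub>moebius_group\<^esub> g) ` \<alpha> = \<alpha>"
      by (simp only: mult_moebius_group image_comp[symmetric] mem_Collect_eq)
    then show "f \<otimes>\<^bsub>moebius_group\<^esub> g \<in> {f \<in> carrier moebius_group. f ` \<alpha> = \<alpha>}"
      using fg m_closed[of f g] by blast
  qed auto
  then show ?thesis
    unfolding set_aut_group_def by (rule subgroup_imp_group)
qed

lemma rotation_in_carrier: "rotation n \<in> carrier moebius_group"
proof -
  have "exp (2 * of_real pi * \<i> / of_nat n) * 1 - 0 * (0::complex) \<noteq> 0" by simp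
  then show ?thesis unfolding rotation_def by (rule sphere_moebius_in_carrier)
qed

lemma carrier_rotation_group:
  "carrier (rotation_group n) =
     {sphere_moebius (exp (of_int j / of_nat n * (2 * of_real pi * \<i>))) 0 0 1 | j :: int. True}"
proof -
  interpret group moebius_group by (rule group_moebius_group)
  define e :: "int \<Rightarrow> complex" where "e j = exp (of_int j / of_nat n * (2 * of_real pi * \<i>))" for j
  have e_add: "e (i + j) = e i * e j" for i j
    by (simp add: e_def exp_add[symmetric] add_divide_distrib distrib_right distrib_left)
  have e_mem: "sphere_moebius (e j) 0 0 1 \<in> carrier moebius_group" for j
  proof -
    have "e j * 1 - 0 * 0 \<noteq> 0" by (simp add: e_def)
    then show ?thesis by (rule sphere_moebius_in_carrier)
  qed
  have e_mult: "sphere_moebius (e i) 0 0 1 \<otimes>\<^bsub>moebius_group\<^esub> sphere_moebius (e j) 0 0 1 = sphere_moebius (e (i + j)) 0 0 1"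
    for i j
    using sphere_moebius_comp[of "e i" 1 0 0 "e j" 1 0 0] by (simp add: moebius_group_def e_add) (simp add: e_def)
  have e_one: "sphere_moebius (e 0) 0 0 1 = \<one>\<^bsub>moebius_group\<^esub>"
    using sphere_moebius_id[of 1] by (simp add: e_def moebius_group_def)
  have r: "rotation n = sphere_moebius (e 1) 0 0 1"
    by (simp add: rotation_def e_def field_simps)
  have nat_pow: "sphere_moebius (e i) 0 0 1 [^]\<^bsub>moebius_group\<^esub> (m::nat) = sphere_moebius (e (i * int m)) 0 0 1" for i m
    by (induction m)
      (simp_all add: e_one e_mult algebra_simps del: mult_moebius_group one_moebius_group)
  have int_pow: "rotation n [^]\<^bsub>moebius_group\<^esub> (j::int) = sphere_moebius (e j) 0 0 1" for j
  proof (cases j)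
    case (nonneg m)
    then show ?thesis using nat_pow[of 1 m] by (simp add: r int_pow_int)
  next
    case (neg m)
    have "inv\<^bsub>moebius_group\<^esub> (sphere_moebius (e (int (Suc m))) 0 0 1) = sphere_moebius (e (- int (Suc m))) 0 0 1"
      by (rule inv_equality) (simp_all only: e_mult e_mem e_one add.left_inverse)
    then show ?thesis
      using neg nat_pow[of 1 "Suc m"] rotation_in_carrier[of n]
      by (simp only: int_pow_neg int_pow_int r mult_1)
  qed
  have "carrier (rotation_group n) = range (\<lambda>j::int. rotation n [^]\<^bsub>moebius_group\<^esub> j)"
    unfolding rotation_group_def
    by (rule carrier_subgroup_generated_by_singleton[OF rotation_in_carrier])
  then show ?thesis by (auto simp: int_pow e_def)
qed

lemma rotation_orbits_eq:
  "rotation_orbits n = {{Infty}, {Fin 0}} \<union> {cyclic_orbit n z | z. z \<noteq> 0}"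
proof -
  have orb: "orbit (rotation_group n) (\<lambda>f. f) x =
      {sphere_moebius (exp (of_int j / of_nat n * (2 * of_real pi * \<i>))) 0 0 1 x | j :: int. True}" for x
    by (auto simp: orbit_def carrier_rotation_group)
  have "orbit (rotation_group n) (\<lambda>f. f) Infty = {Infty}"
    and "orbit (rotation_group n) (\<lambda>f. f) (Fin 0) = {Fin 0}"
    and "orbit (rotation_group n) (\<lambda>f. f) (Fin z) = cyclic_orbit n z" for z
    by (auto simp: orb cyclic_orbit_def moebius_def)
  then have "orbit (rotation_group n) (\<lambda>f. f) x \<in> {{Infty}, {Fin 0}} \<union> {cyclic_orbit n z | z. z \<noteq> 0}"
    and "{Infty} \<in> rotation_orbits n" "{Fin 0} \<in> rotation_orbits n"
    and "cyclic_orbit n z \<in> rotation_orbits n" for x z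
    unfolding rotation_orbits_def orbits_def
    by (cases x; blast | metis (mono_tags, lifting) UNIV_I mem_Collect_eq)+
  then show ?thesis
    by (auto simp: rotation_orbits_def orbits_def)
qed

end

theory Submission
  imports Defs "HOL-Computational_Algebra.Fundamental_Theorem_Algebra"
begin

text \<open>
  A group of Moebius transformations that is cyclic of order \<open>n\<close> is conjugate to the group of
  rotations \<open>z \<mapsto> \<zeta> z\<close> with \<open>\<zeta> ^ n = 1\<close>: a generator has finite order, so it is not conjugate to a
  nontrivial translation and has two fixed points, which can be moved to \<open>\<infinity>\<close> and \<open>0\<close>
  (\<open>conjugate_set_aut_group_to_rotations\<close>). The finite sets invariant under these rotations are the sets \<open>N \<union> {z. z ^ n \<in> U}\<close> with \<open>N \<subseteq> {\<infinity>, 0}\<close> and a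
  finite set \<open>U\<close> of nonzero numbers; the component index of such a set is \<open>(|N|, |U|)\<close>, and its
  cardinality is \<open>|N| + n |U|\<close>. Everything therefore reduces to one question: for which
  \<open>(|N|, |U|)\<close> can the symmetry group of this set be as small as the group of rotations?

  The excluded indices have a visible extra symmetry (\<open>rotation_group_forces_realizable\<close>). If \<open>U\<close> is
  empty, all dilations are symmetries. If \<open>U = {u, v}\<close>, possibly with \<open>u = v\<close>, and \<open>N\<close> is empty or full,
  then \<open>z \<mapsto> w / z\<close> with \<open>w ^ n = u v\<close> is one. If \<open>|N| = |U| = 1\<close>, the set is the apex and base of a
  pyramid; for \<open>n = 3\<close> this is a regular tetrahedron and for \<open>n = 2\<close> a set of three points, so the apex
  can be moved.

  For all other indices, take \<open>U\<close> on the unit circle without rotational symmetry and, if it has at least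
  three elements, without reflection symmetry (\<open>rotation_group_of_chiral_configuration\<close>). A symmetry
  \<open>f\<close> of the resulting set sends at least three points of the circle to points of the circle, so it
  preserves the circle, hence also \<open>N\<close>. If \<open>N\<close> is nonempty, \<open>f\<close> permutes \<open>\<infinity>\<close> and \<open>0\<close>, because it
  commutes with inversion in the circle. If \<open>N\<close> is empty, the same follows from a comparison of
  discriminants: \<open>f\<close> permutes the set \<open>S = {w. w ^ n \<in> U}\<close>, so it preserves the product of the distances
  between its points. For \<open>f z = (a z + b) / (c z + d)\<close> with determinant \<open>D\<close> this forces
  \<open>(\<Prod>w\<in>S. |c w + d|)\<^sup>2 = |D| ^ |S|\<close>, whereas \<open>\<Prod>w\<in>S. |c w + d|\<close> equals
  \<open>\<Prod>u\<in>U. |d ^ n - (- c) ^ n u|\<close>, each factor of which is at least \<open>||d|\<^sup>2 - |c|\<^sup>2| ^ (n/2) = |D| ^ (n/2)\<close>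
  with equality for at most one \<open>u\<close> unless \<open>c d = 0\<close> (\<open>unitary_moebius_permutation\<close>). In every case
  \<open>f\<close> is \<open>z \<mapsto> p z\<close> or \<open>z \<mapsto> p / z\<close>; it acts on \<open>U\<close> as a rotation or as a reflection. A
  reflection is impossible by the choice of \<open>U\<close> if \<open>|U| \<ge> 3\<close>, and otherwise because \<open>N\<close> is a single
  pole, which \<open>z \<mapsto> p / z\<close> does not fix. A rotation of \<open>U\<close> is the identity, so \<open>p ^ n = 1\<close>.
\<close>

section \<open>Moebius transformations as permutations of the sphere\<close>

lemma moebius_map_inverse:
  assumes "f \<in> carrier moebius_group"
  obtains g where "g \<in> carrier moebius_group" "g \<circ> f = id" "f \<circ> g = id"
proof -
  interpret group moebius_group by (rule group_moebius_group)
  show ?thesis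
    using that[of "inv\<^bsub>moebius_group\<^esub> f"] l_inv[OF assms] r_inv[OF assms] inv_closed[OF assms]
    by simp
qed

lemma moebius_map_inj: "f \<in> carrier moebius_group \<Longrightarrow> inj f"
  by (metis moebius_map_inverse inj_on_id inj_on_imageI2)

lemma moebius_comp_closed:
  "f \<in> carrier moebius_group \<Longrightarrow> g \<in> carrier moebius_group \<Longrightarrow> f \<circ> g \<in> carrier moebius_group"
  using monoid.m_closed[OF group.is_monoid[OF group_moebius_group], of f g] by simp

lemma moebius_map_cases:
  assumes "f \<in> carrier moebius_group"
  obtains a b c d where "f = sphere_moebius a b c d" "a * d - b * c \<noteq> 0"
  using assms unfolding moebius_group_def by auto

lemma mem_set_aut_group:
  "f \<in> carrier (set_aut_group \<alpha>) \<longleftrightarrow> f \<in> carrier moebius_group \<and> f ` \<alpha> = \<alpha>"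
  by (simp add: set_aut_group_def)

lemma set_aut_group_ops [simp]:
  "f \<otimes>\<^bsub>set_aut_group \<alpha>\<^esub> g = f \<circ> g" "\<one>\<^bsub>set_aut_group \<alpha>\<^esub> = id"
  by (simp_all add: set_aut_group_def moebius_group_def)

text \<open>
  An injective map of a finite set into itself is onto, so for finite sets invariance needs to be
  checked in one direction only.
\<close>

lemma mem_set_aut_groupI:
  assumes "f \<in> carrier moebius_group" "finite \<alpha>" "f ` \<alpha> \<subseteq> \<alpha>"
  shows "f \<in> carrier (set_aut_group \<alpha>)"
  using assms moebius_map_inj[OF assms(1)] endo_inj_surj[OF assms(2,3)]
  by (auto simp: mem_set_aut_group intro: inj_on_subset)

section \<open>Dilations and the rotations of finite order\<close>

abbreviation dilation :: "complex \<Rightarrow> riemann_sphere \<Rightarrow> riemann_sphere" where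
  "dilation p \<equiv> sphere_moebius p 0 0 1"

lemma dilation_Fin: "dilation p (Fin z) = Fin (p * z)"
  by (simp add: moebius_def)

lemma dilation_comp: "dilation p \<circ> dilation q = dilation (p * q)"
proof
  fix x show "(dilation p \<circ> dilation q) x = dilation (p * q) x"
    by (cases x) (simp_all add: moebius_def)
qed

lemma dilation_eq_iff: "dilation p = dilation q \<longleftrightarrow> p = q"
  by (metis dilation_Fin mult.right_neutral riemann_sphere.inject)

lemma dilation_one: "dilation 1 = id"
  by (simp add: sphere_moebius_id)

lemma dilation_in_carrier: "p \<noteq> 0 \<Longrightarrow> dilation p \<in> carrier moebius_group"
  by (rule sphere_moebius_in_carrier) simp

definition rotations :: "nat \<Rightarrow> (riemann_sphere \<Rightarrow> riemann_sphere) set" where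
  "rotations n = dilation ` {\<zeta>. \<zeta> ^ n = 1}"

lemma card_rotations:
  assumes "n \<ge> 1" shows "card (rotations n) = n" "finite (rotations n)"
proof -
  have "inj_on dilation {\<zeta>. \<zeta> ^ n = 1}"
    by (auto simp: inj_on_def dilation_eq_iff)
  then show "card (rotations n) = n"
    using assms by (simp add: rotations_def card_image card_complex_roots_unity)
  show "finite (rotations n)"
    using assms by (simp add: rotations_def finite_roots_unity)
qed

lemma rotations_subset:
  assumes "n \<ge> 1" shows "rotations n \<subseteq> carrier moebius_group"
  using assms by (auto simp: rotations_def intro!: dilation_in_carrier simp: power_0_left)

text \<open>
  The isomorphism is \<open>j \<mapsto> exp (2 \<pi> i j / n)\<close>, read as a rotation.
\<close>

lemma set_aut_group_iso_cyclic:
  assumes "carrier (set_aut_group \<alpha>) = rotations n" "n \<ge> 1"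
  shows "set_aut_group \<alpha> \<cong> integer_mod_group n"
proof -
  define e :: "int \<Rightarrow> complex" where "e j = cis (2 * pi * j / n)" for j
  have e_add: "e (i + j) = e i * e j" for i j
    by (simp add: e_def cis_mult distrib_left add_divide_distrib)
  have e_n: "e (int n * j) = 1" for j
    using assms(2) cis_multiple_2pi[of "of_int j"] by (simp add: e_def mult.assoc)
  have e_mod: "e (j mod int n) = e j" for j
    using e_add[of "int n * (j div int n)" "j mod int n"] by (simp add: e_n)
  have bij: "bij_betw e {0..<int n} {\<zeta>. \<zeta> ^ n = 1}"
  proof -
    have "bij_betw (\<lambda>k. cis (2 * pi * real k / real n)) {..<n} {\<zeta>. \<zeta> ^ n = 1}"
      using Complex.bij_betw_roots_unity[of n] assms(2) by simp
    also have "(\<lambda>k. cis (2 * pi * real k / real n)) = e \<circ> int"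
      by (simp add: e_def fun_eq_iff)
    finally have "bij_betw (e \<circ> int) {..<n} {\<zeta>. \<zeta> ^ n = 1}" .
    moreover have "bij_betw int {..<n} {0..<int n}"
      using image_int_atLeastLessThan[of 0 n] by (simp add: bij_betw_def lessThan_atLeast0)
    ultimately show ?thesis
      using bij_betw_comp_iff by blast
  qed
  have "bij_betw dilation {\<zeta>. \<zeta> ^ n = 1} (rotations n)"
    by (simp add: bij_betw_def rotations_def inj_on_def dilation_eq_iff)
  then have "bij_betw (\<lambda>j. dilation (e j)) (carrier (integer_mod_group n)) (rotations n)"
    using bij_betw_trans[OF bij] assms(2) by (simp add: carrier_integer_mod_group comp_def)
  moreover have "(\<lambda>j. dilation (e j)) \<in> hom (integer_mod_group n) (set_aut_group \<alpha>)"
    using calculation assms(1)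
    by (auto simp: hom_def bij_betw_def e_mod e_add dilation_comp)
  ultimately have "integer_mod_group n \<cong> set_aut_group \<alpha>"
    using assms(1) by (auto simp: is_iso_def iso_def)
  then show ?thesis
    by (rule group.iso_sym[OF group_integer_mod_group])
qed

text \<open>
  The residue \<open>1\<close> corresponds to a generator \<open>g\<close>. The group operation is composition, so the powers of
  \<open>g\<close> in the group are its iterates.
\<close>

lemma cyclic_set_aut_group_generator:
  assumes "set_aut_group \<alpha> \<cong> integer_mod_group n" "n \<ge> 2"
  obtains g where "carrier (set_aut_group \<alpha>) = (\<lambda>j. g ^^ j) ` {..<n}" "g ^^ n = id"
    "card (carrier (set_aut_group \<alpha>)) = n"
proof -
  have "integer_mod_group n \<cong> set_aut_group \<alpha>"
    using assms(1) by (rule group.iso_sym[OF group_set_aut_group])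
  then obtain \<phi> where hom: "\<phi> \<in> hom (integer_mod_group n) (set_aut_group \<alpha>)"
    and bij: "bij_betw \<phi> {0..<int n} (carrier (set_aut_group \<alpha>))"
    using assms(2) by (auto simp: is_iso_def iso_def carrier_integer_mod_group)
  have add: "\<phi> ((i + j) mod int n) = \<phi> i \<circ> \<phi> j" if "i \<in> {0..<int n}" "j \<in> {0..<int n}" for i j
    using hom_mult[OF hom, of i j] that assms(2) by (simp add: carrier_integer_mod_group)
  have zero: "\<phi> 0 = id"
    using hom_one[OF hom group_integer_mod_group group_set_aut_group] by simp
  have pow: "\<phi> (int j mod int n) = \<phi> 1 ^^ j" for j
  proof (induction j)
    case (Suc j)
    have "\<phi> (int (Suc j) mod int n) = \<phi> ((1 + int j mod int n) mod int n)"
      by (simp add: mod_add_right_eq)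
    also have "\<dots> = \<phi> 1 \<circ> \<phi> (int j mod int n)"
      using assms(2) by (intro add) auto
    finally show ?case using Suc by simp
  qed (simp add: zero)
  have "carrier (set_aut_group \<alpha>) = \<phi> ` {0..<int n}"
    using bij by (simp add: bij_betw_def)
  also have "\<dots> = \<phi> ` int ` {..<n}"
    using image_int_atLeastLessThan[of 0 n] by (simp add: lessThan_atLeast0)
  also have "\<dots> = (\<lambda>j. \<phi> 1 ^^ j) ` {..<n}"
    unfolding image_image
  proof (rule image_cong)
    fix j assume "j \<in> {..<n}"
    then show "\<phi> (int j) = \<phi> 1 ^^ j" using pow[of j] by simp
  qed simp
  finally show ?thesis
    using that[of "\<phi> 1"] pow[of n] zero bij_betw_same_card[OF bij] by simp
qed

section \<open>Conjugating a finite cyclic group to rotations\<close>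

text \<open>
  Moving a fixed point of \<open>g\<close> to \<open>\<infinity>\<close> makes \<open>g\<close> affine. An affine map that is not a translation has a
  second fixed point, which is then moved to \<open>0\<close>.
\<close>

lemma conjugate_to_dilation:
  assumes g: "g \<in> carrier moebius_group" "g \<noteq> id" "g ^^ n = id" "n \<ge> 1"
  obtains h h' p where "h \<in> carrier moebius_group" "h' \<in> carrier moebius_group"
    "h' \<circ> h = id" "h \<circ> h' = id" "h \<circ> g \<circ> h' = dilation p"
proof -
  obtain a b c d where g_eq: "g = sphere_moebius a b c d" and D: "a * d - b * c \<noteq> 0"
    using g(1) by (rule moebius_map_cases)
  have "\<exists>x. g x = x"
  proof (cases "c = 0")
    case True
    then show ?thesis using g_eq by (intro exI[of _ Infty]) simp
  next
    case False
    \<comment> \<open>The finite fixed points are the roots of \<open>c z\<^sup>2 + (d - a) z - b\<close>.\<close>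
    define s where "s = csqrt ((d - a)\<^sup>2 + 4 * b * c)"
    define z where "z = (a - d + s) / (2 * c)"
    have "s\<^sup>2 = (d - a)\<^sup>2 + 4 * b * c" by (simp add: s_def)
    moreover have z: "2 * c * z = a - d + s" using False by (simp add: z_def)
    ultimately have "(2 * c * z - (a - d))\<^sup>2 = (d - a)\<^sup>2 + 4 * b * c" by simp
    then have "4 * c * (z * (c * z + d)) = 4 * c * (a * z + b)"
      by (simp add: power2_eq_square algebra_simps)
    then have root: "z * (c * z + d) = a * z + b" using False by simp
    have "c * z + d \<noteq> 0"
    proof
      assume 0: "c * z + d = 0"
      then have "a * z + b = 0" using root by simp
      then have "a * d - b * c = 0" using 0 by algebra
      then show False using D by simp
    qed
    then show ?thesis using g_eq root by (intro exI[of _ "Fin z"]) (simp add: moebius_def field_simps)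
  qed
  then obtain x where x: "g x = x" ..
  obtain h1 where h1: "h1 \<in> carrier moebius_group" "h1 x = Infty"
  proof (cases x)
    case (Fin z)
    have "sphere_moebius 0 1 1 (- z) \<in> carrier moebius_group"
      by (rule sphere_moebius_in_carrier) simp
    moreover have "sphere_moebius 0 1 1 (- z) x = Infty" using Fin by simp
    ultimately show ?thesis by (rule that)
  next
    case Infty
    then show ?thesis using that[of id] dilation_in_carrier[of 1] by (simp add: dilation_one)
  qed
  obtain k1 where k1: "k1 \<in> carrier moebius_group" "k1 \<circ> h1 = id" "h1 \<circ> k1 = id"
    using h1(1) by (rule moebius_map_inverse)
  define g1 where "g1 = h1 \<circ> g \<circ> k1"
  have g1_car: "g1 \<in> carrier moebius_group"
    unfolding g1_def by (intro moebius_comp_closed h1 k1 g)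
  have "k1 Infty = x" using k1(2) h1(2) by (metis comp_apply id_apply)
  then have g1_inf: "g1 Infty = Infty" using x h1 by (simp add: g1_def)
  have pow1: "g1 ^^ m = h1 \<circ> g ^^ m \<circ> k1" for m
  proof (induction m)
    case (Suc m)
    have "g1 ^^ Suc m = (h1 \<circ> g) \<circ> (k1 \<circ> h1) \<circ> (g ^^ m \<circ> k1)"
      by (simp only: funpow.simps Suc) (simp only: g1_def comp_assoc)
    then show ?case by (simp add: k1 comp_assoc)
  qed (simp add: k1)
  have g1_n: "g1 ^^ n = id" by (simp add: pow1 g k1)
  obtain a1 b1 c1 d1 where g1_eq: "g1 = sphere_moebius a1 b1 c1 d1" and D1: "a1 * d1 - b1 * c1 \<noteq> 0"
    using g1_car by (rule moebius_map_cases)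
  have c1: "c1 = 0" using g1_inf g1_eq by (simp split: if_split_asm)
  then have a1: "a1 \<noteq> 0" "d1 \<noteq> 0" using D1 by auto
  have g1_Fin: "g1 (Fin z) = Fin ((a1 * z + b1) / d1)" for z
    using g1_eq c1 a1 by (simp add: moebius_def)
  have "a1 \<noteq> d1"
  proof
    assume ad: "a1 = d1"
    \<comment> \<open>A translation of finite order is the identity.\<close>
    have "(g1 ^^ m) (Fin 0) = Fin (of_nat m * (b1 / d1))" for m
      using a1 by (induction m) (simp_all add: g1_Fin ad field_simps)
    then have "b1 = 0" using g1_n g(4) a1 by (metis id_apply divide_eq_0_iff mult_eq_0_iff not_one_le_zero of_nat_eq_0_iff riemann_sphere.inject)
    then have "g1 = id" using g1_eq c1 ad a1 by (simp add: sphere_moebius_id)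
    then have "k1 \<circ> g1 \<circ> h1 = id" using k1 by simp
    moreover have "k1 \<circ> g1 \<circ> h1 = (k1 \<circ> h1) \<circ> g \<circ> (k1 \<circ> h1)" by (simp add: g1_def comp_assoc)
    ultimately show False using k1 g by simp
  qed
  \<comment> \<open>the finite fixed point of \<open>z \<mapsto> (a1 z + b1) / d1\<close>\<close>
  define w where "w = b1 / (d1 - a1)"
  define h2 where "h2 = sphere_moebius 1 (- w) 0 1"
  define k2 where "k2 = sphere_moebius 1 w 0 1"
  have h2: "h2 \<in> carrier moebius_group" "k2 \<in> carrier moebius_group"
    unfolding h2_def k2_def by (simp_all add: sphere_moebius_in_carrier)
  have hk: "k2 \<circ> h2 = id" "h2 \<circ> k2 = id"
    using sphere_moebius_comp[of 1 1 "-w" 0 1 1 w 0] sphere_moebius_comp[of 1 1 w 0 1 1 "-w" 0]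
    by (simp_all add: h2_def k2_def sphere_moebius_id)
  have "h2 \<circ> g1 \<circ> k2 = dilation (a1 / d1)"
  proof
    fix y show "(h2 \<circ> g1 \<circ> k2) y = dilation (a1 / d1) y"
    proof (cases y)
      case (Fin z)
      have "w * (d1 - a1) = b1" using \<open>a1 \<noteq> d1\<close> by (simp add: w_def)
      then have "a1 * (z + w) + b1 - w * d1 = a1 * z" by (auto simp: algebra_simps)
      then show ?thesis using Fin a1 by (simp add: g1_Fin h2_def k2_def moebius_def field_simps)
    qed (simp add: h2_def k2_def g1_inf)
  qed
  then have "(h2 \<circ> h1) \<circ> g \<circ> (k1 \<circ> k2) = dilation (a1 / d1)" by (simp add: g1_def comp_assoc)
  moreover have "(k1 \<circ> k2) \<circ> (h2 \<circ> h1) = id"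
    using hk k1 by (metis comp_assoc comp_id)
  moreover have "(h2 \<circ> h1) \<circ> (k1 \<circ> k2) = id"
    using hk k1 by (metis comp_assoc comp_id)
  ultimately show ?thesis
    using that moebius_comp_closed h1 k1 h2 by blast
qed

text \<open>
  Conjugating the symmetry group of \<open>\<alpha>\<close> by \<open>h\<close> gives the symmetry group of \<open>h ` \<alpha>\<close>. Once the
  generator is a dilation by \<open>p\<close>, all \<open>n\<close> elements are dilations by powers of \<open>p\<close>; as \<open>p ^ n = 1\<close>, they
  are \<open>n\<close> of the \<open>n\<close> rotations, hence all of them.
\<close>

lemma conjugate_set_aut_group_to_rotations:
  assumes "set_aut_group \<alpha> \<cong> integer_mod_group n" "n \<ge> 2"
  obtains h where "h \<in> carrier moebius_group" "carrier (set_aut_group (h ` \<alpha>)) = rotations n"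
proof -
  obtain g where g: "carrier (set_aut_group \<alpha>) = (\<lambda>j. g ^^ j) ` {..<n}" "g ^^ n = id"
    and card: "card (carrier (set_aut_group \<alpha>)) = n"
    using cyclic_set_aut_group_generator[OF assms] by metis
  have "g ^^ 1 \<in> carrier (set_aut_group \<alpha>)" using assms(2) unfolding g(1) by (intro imageI) auto
  then have g_car: "g \<in> carrier moebius_group" by (simp add: mem_set_aut_group)
  have "g \<noteq> id"
  proof
    assume "g = id"
    then have "carrier (set_aut_group \<alpha>) \<subseteq> {id}" using g(1) by auto
    then show False using card assms(2) card_mono[of "{id}" "carrier (set_aut_group \<alpha>)"] by simp
  qed
  then obtain h h' p where h: "h \<in> carrier moebius_group" "h' \<in> carrier moebius_group"
    "h' \<circ> h = id" "h \<circ> h' = id" "h \<circ> g \<circ> h' = dilation p"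
    using conjugate_to_dilation[OF g_car _ g(2)] assms(2) by (metis One_nat_def Suc_leD numeral_2_eq_2)
  have pow: "h \<circ> g ^^ m \<circ> h' = dilation (p ^ m)" for m
  proof (induction m)
    case (Suc m)
    have "h \<circ> g ^^ Suc m \<circ> h' = h \<circ> g \<circ> (h' \<circ> h) \<circ> g ^^ m \<circ> h'"
      using h by (simp add: comp_assoc)
    also have "\<dots> = (h \<circ> g \<circ> h') \<circ> (h \<circ> g ^^ m \<circ> h')" by (simp only: comp_assoc)
    also have "\<dots> = dilation (p ^ Suc m)" by (simp only: Suc h dilation_comp power_Suc)
    finally show ?case .
  qed (simp add: h dilation_one)
  have "dilation (p ^ n) = dilation 1"
    using pow[of n] g(2) h(4) by (simp add: dilation_one)
  then have "p ^ n = 1" by (simp only: dilation_eq_iff)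
  have conj: "carrier (set_aut_group (h ` \<alpha>)) = (\<lambda>f. h \<circ> f \<circ> h') ` carrier (set_aut_group \<alpha>)"
  proof (intro equalityI subsetI)
    fix f assume "f \<in> carrier (set_aut_group (h ` \<alpha>))"
    then have f: "f \<in> carrier moebius_group" "f ` h ` \<alpha> = h ` \<alpha>" by (auto simp: mem_set_aut_group)
    have "(h' \<circ> f \<circ> h) ` \<alpha> = (h' \<circ> h) ` \<alpha>" by (simp only: image_comp[symmetric] f)
    then have "h' \<circ> f \<circ> h \<in> carrier (set_aut_group \<alpha>)"
      using f h by (simp add: mem_set_aut_group moebius_comp_closed)
    moreover have "f = h \<circ> (h' \<circ> f \<circ> h) \<circ> h'" using h by (metis comp_assoc comp_id id_comp)
    ultimately show "f \<in> (\<lambda>f. h \<circ> f \<circ> h') ` carrier (set_aut_group \<alpha>)" by blast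
  next
    fix f assume "f \<in> (\<lambda>f. h \<circ> f \<circ> h') ` carrier (set_aut_group \<alpha>)"
    then obtain k where k: "f = h \<circ> k \<circ> h'" "k \<in> carrier moebius_group" "k ` \<alpha> = \<alpha>"
      by (auto simp: mem_set_aut_group)
    have "f ` h ` \<alpha> = h ` k ` (h' \<circ> h) ` \<alpha>" using k by (simp add: image_comp comp_assoc)
    then show "f \<in> carrier (set_aut_group (h ` \<alpha>))"
      using k h by (simp add: mem_set_aut_group moebius_comp_closed)
  qed
  have sub: "carrier (set_aut_group (h ` \<alpha>)) \<subseteq> rotations n"
  proof -
    have "(p ^ j) ^ n = 1" for j
      using \<open>p ^ n = 1\<close> by (metis mult.commute power_mult power_one)
    then show ?thesis unfolding conj g(1) by (auto simp only: pow rotations_def)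
  qed
  have "inj_on (\<lambda>f. h \<circ> f \<circ> h') (carrier (set_aut_group \<alpha>))"
    by (rule inj_on_inverseI[of _ "\<lambda>f. h' \<circ> f \<circ> h"]) (metis h(3) comp_assoc comp_id id_comp)
  then have "card (carrier (set_aut_group (h ` \<alpha>))) = n" by (simp add: conj card_image card)
  then have "carrier (set_aut_group (h ` \<alpha>)) = rotations n"
    using sub card_rotations[of n] assms(2) by (intro card_subset_eq) auto
  then show ?thesis using that h by blast
qed

section \<open>Finite sets invariant under rotations\<close>

text \<open>
  The normal form of a rotation-invariant set: \<open>N\<close> consists of the poles \<open>\<infinity>\<close> and \<open>0\<close> in the set. The
  map \<open>z \<mapsto> z ^ n\<close> collapses each orbit outside the poles to one point, so \<open>U\<close> has one element for each of
  these orbits.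
\<close>

definition sphere_roots :: "nat \<Rightarrow> riemann_sphere set \<Rightarrow> complex set \<Rightarrow> riemann_sphere set" where
  "sphere_roots n N U = N \<union> Fin ` {z. z ^ n \<in> U}"

lemma finite_roots_of_set:
  assumes "n \<ge> 1" "finite U"
  shows "finite {z::complex. z ^ n \<in> U}"
proof -
  have "{z::complex. z ^ n \<in> U} = (\<Union>u\<in>U. {z. z ^ n = u})" by auto
  then show ?thesis using assms by auto
qed

lemma card_roots_of_set:
  assumes "n \<ge> 1" "finite U" "0 \<notin> U"
  shows "card {z::complex. z ^ n \<in> U} = n * card U"
proof -
  have "{z::complex. z ^ n \<in> U} = (\<Union>u\<in>U. {z. z ^ n = u})" by auto
  also have "card \<dots> = (\<Sum>u\<in>U. card {z. z ^ n = u})"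
    using assms by (intro card_UN_disjoint) auto
  also have "\<dots> = (\<Sum>u\<in>U. n)"
    using assms by (intro sum.cong card_nth_roots) auto
  finally show ?thesis by simp
qed

lemma card_sphere_roots:
  assumes "n \<ge> 1" "N \<subseteq> {Infty, Fin 0}" "finite U" "0 \<notin> U"
  shows "finite (sphere_roots n N U)" "card (sphere_roots n N U) = card N + n * card U"
proof -
  have fin: "finite N" "finite {z::complex. z ^ n \<in> U}"
    using assms finite_roots_of_set[of n U] finite_subset[OF assms(2)] by auto
  then show "finite (sphere_roots n N U)" by (simp add: sphere_roots_def)
  have "N \<inter> Fin ` {z. z ^ n \<in> U} = {}" using assms by (auto simp: power_0_left)
  then have "card (sphere_roots n N U) = card N + card (Fin ` {z. z ^ n \<in> U})"
    unfolding sphere_roots_def using fin by (intro card_Un_disjoint) auto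
  also have "card (Fin ` {z. z ^ n \<in> U}) = n * card U"
    using card_roots_of_set[OF assms(1,3,4)] by (subst card_image) (auto simp: inj_on_def)
  finally show "card (sphere_roots n N U) = card N + n * card U" .
qed

lemma rotation_invariant_normal_form:
  assumes "rotations n \<subseteq> carrier (set_aut_group \<beta>)" "finite \<beta>" "n \<ge> 1"
  obtains N U where "N \<subseteq> {Infty, Fin 0}" "finite U" "0 \<notin> U" "\<beta> = sphere_roots n N U"
proof
  let ?U = "(\<lambda>z. z ^ n) ` {z. z \<noteq> 0 \<and> Fin z \<in> \<beta>}"
  show "\<beta> \<inter> {Infty, Fin 0} \<subseteq> {Infty, Fin 0}" by simp
  have "finite (Fin -` \<beta>)"
    using assms(2) by (intro finite_vimageI) (auto simp: inj_on_def)
  then show "finite ?U"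
    by (intro finite_imageI) (rule finite_subset[of _ "Fin -` \<beta>"], auto)
  show "0 \<notin> ?U" by auto
  have "Fin z \<in> \<beta>" if z: "z ^ n = w ^ n" "w \<noteq> 0" "Fin w \<in> \<beta>" for z w
  proof -
    have "(z / w) ^ n = 1" using z by (simp add: power_divide)
    then have "dilation (z / w) \<in> carrier (set_aut_group \<beta>)"
      using assms(1) by (auto simp: rotations_def)
    then have "dilation (z / w) (Fin w) \<in> \<beta>"
      using z(3) unfolding mem_set_aut_group by blast
    then show ?thesis using z(2) by (simp only: dilation_Fin) simp
  qed
  moreover have "x \<in> {Infty, Fin 0} \<or> (\<exists>z. z \<noteq> 0 \<and> x = Fin z)" for x
    by (cases x) auto
  ultimately show "\<beta> = sphere_roots n (\<beta> \<inter> {Infty, Fin 0}) ?U"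
    unfolding sphere_roots_def by fast
qed

lemma sphere_roots_rotation_invariant:
  assumes "n \<ge> 1" "N \<subseteq> {Infty, Fin 0}" "finite U" "0 \<notin> U"
  shows "rotations n \<subseteq> carrier (set_aut_group (sphere_roots n N U))"
proof
  fix f assume f: "f \<in> rotations n"
  then obtain \<zeta> where \<zeta>: "f = dilation \<zeta>" "\<zeta> ^ n = 1" by (auto simp: rotations_def)
  show "f \<in> carrier (set_aut_group (sphere_roots n N U))"
  proof (rule mem_set_aut_groupI)
    show "f \<in> carrier moebius_group" using f rotations_subset[OF assms(1)] by auto
    show "finite (sphere_roots n N U)" by (rule card_sphere_roots[OF assms])
    show "f ` sphere_roots n N U \<subseteq> sphere_roots n N U"
      using assms(2) by (auto simp: sphere_roots_def \<zeta> moebius_def power_mult_distrib)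
  qed
qed

lemma cyclic_orbit_eq:
  assumes "n \<ge> 1"
  shows "cyclic_orbit n z = Fin ` {w. w ^ n = z ^ n}"
proof -
  have eq: "exp (of_int j / of_nat n * (2 * of_real pi * \<i>)) = cis (2 * pi * j / n)" for j :: int
    by (simp add: cis_conv_exp mult_ac)
  have "\<exists>j::int. w = cis (2 * pi * j / n) * z" if "w ^ n = z ^ n" for w
  proof (cases "z = 0")
    case True
    then show ?thesis using that assms by (simp add: power_0_left)
  next
    case False
    then have "w / z \<in> {\<zeta>. \<zeta> ^ n = 1}" using that by (simp add: power_divide)
    then obtain k where "w / z = cis (2 * pi * real k / real n)"
      using Complex.bij_betw_roots_unity[of n] assms by (auto simp: bij_betw_def)
    then have "w = cis (2 * pi * of_int (int k) / real n) * z" using False by (simp add: field_simps)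
    then show ?thesis by blast
  qed
  moreover have "(cis (2 * pi * j / n) * z) ^ n = z ^ n" for j :: int
  proof -
    have "real n * (2 * pi * j / n) = 2 * pi * of_int j" using assms by simp
    then have "cis (2 * pi * j / n) ^ n = cis (2 * pi * of_int j)" by (simp only: Complex.DeMoivre)
    then show ?thesis using cis_multiple_2pi[of "of_int j"] by (simp add: power_mult_distrib)
  qed
  ultimately show ?thesis
    unfolding cyclic_orbit_def eq by blast
qed

lemma nth_root_exists:
  assumes "n \<ge> 1" shows "\<exists>w::complex. w ^ n = u"
proof (cases "u = 0")
  case False
  then have "card {w. w ^ n = u} = n" using assms by (intro card_nth_roots) auto
  then show ?thesis using assms by (metis (mono_tags, lifting) card.empty empty_Collect_eq not_one_le_zero)
qed (use assms in \<open>auto simp: power_0_left intro!: exI[of _ 0]\<close>)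

text \<open>
  This translates the component index into the normal form. It rests on the fact that both
  \<open>x \<mapsto> {x}\<close> and \<open>u \<mapsto> {w. w ^ n = u}\<close> are injective, so that counting orbits inside the set is
  counting the elements of \<open>N\<close> and of \<open>U\<close>.
\<close>

lemma has_cyclic_index_iff:
  assumes "n \<ge> 1"
  shows "has_cyclic_index n \<alpha> (\<nu>, k) \<longleftrightarrow>
    (\<exists>N U. N \<subseteq> {Infty, Fin 0} \<and> finite U \<and> 0 \<notin> U \<and> card N = \<nu> \<and> card U = k \<and> \<alpha> = sphere_roots n N U)"
proof -
  have fixed: "card {B. B \<in> {{Infty}, {Fin 0}} \<and> B \<subseteq> sphere_roots n N U} = card N"
    if "N \<subseteq> {Infty, Fin 0}" "0 \<notin> U" for N and U :: "complex set"
  proof -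
    have "{B. B \<in> {{Infty}, {Fin 0}} \<and> B \<subseteq> sphere_roots n N U} = (\<lambda>x. {x}) ` N"
      using that assms by (auto simp: sphere_roots_def power_0_left)
    then show ?thesis by (simp add: card_image)
  qed
  have free: "card {B. (\<exists>z. z \<noteq> 0 \<and> B = cyclic_orbit n z) \<and> B \<subseteq> sphere_roots n N U} = card U"
    if "N \<subseteq> {Infty, Fin 0}" "0 \<notin> U" for N and U :: "complex set"
  proof -
    have "{B. (\<exists>z. z \<noteq> 0 \<and> B = cyclic_orbit n z) \<and> B \<subseteq> sphere_roots n N U}
        = (\<lambda>u. Fin ` {w. w ^ n = u}) ` U"
    proof (intro equalityI subsetI)
      fix B assume "B \<in> {B. (\<exists>z. z \<noteq> 0 \<and> B = cyclic_orbit n z) \<and> B \<subseteq> sphere_roots n N U}"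
      then obtain z where z: "z \<noteq> 0" "B = Fin ` {w. w ^ n = z ^ n}" "B \<subseteq> sphere_roots n N U"
        using cyclic_orbit_eq[OF assms] by auto
      then have "Fin z \<in> sphere_roots n N U" by auto
      then have "z ^ n \<in> U" using z(1) that by (auto simp: sphere_roots_def)
      then show "B \<in> (\<lambda>u. Fin ` {w. w ^ n = u}) ` U" using z by blast
    next
      fix B assume "B \<in> (\<lambda>u. Fin ` {w. w ^ n = u}) ` U"
      then obtain u where u: "u \<in> U" "B = Fin ` {w. w ^ n = u}" by auto
      obtain z where z: "z ^ n = u" using nth_root_exists[OF assms] by blast
      then have "z \<noteq> 0" using u that assms by (auto simp: power_0_left)
      then show "B \<in> {B. (\<exists>z. z \<noteq> 0 \<and> B = cyclic_orbit n z) \<and> B \<subseteq> sphere_roots n N U}"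
        using u z cyclic_orbit_eq[OF assms, of z] by (auto simp: sphere_roots_def)
    qed
    moreover have "inj_on (\<lambda>u. Fin ` {w. w ^ n = u}) U"
    proof (rule inj_onI)
      fix u v :: complex assume eq: "Fin ` {w. w ^ n = u} = Fin ` {w. w ^ n = v}"
      obtain z where z: "z ^ n = u" using nth_root_exists[OF assms] by blast
      then have "Fin z \<in> Fin ` {w. w ^ n = v}" by (auto simp flip: eq)
      then show "u = v" using z by auto
    qed
    ultimately show ?thesis by (simp add: card_image)
  qed
  show ?thesis
  proof
    assume idx: "has_cyclic_index n \<alpha> (\<nu>, k)"
    then obtain \<O> where \<O>: "\<O> \<subseteq> rotation_orbits n" "finite \<O>" "\<alpha> = \<Union>\<O>"
      by (auto simp: has_cyclic_index_def)
    have orb: "B \<in> {{Infty}, {Fin 0}} \<or> (\<exists>z. z \<noteq> 0 \<and> B = Fin ` {w. w ^ n = z ^ n})" if "B \<in> \<O>" for B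
      using that \<O>(1) cyclic_orbit_eq[OF assms] by (auto simp: rotation_orbits_eq)
    have fin: "finite \<alpha>"
      unfolding \<O>(3) using \<O>(2) orb assms by (force intro!: finite_Union)
    have "rotations n \<subseteq> carrier (set_aut_group \<alpha>)"
    proof
      fix f assume f: "f \<in> rotations n"
      then obtain \<zeta> where \<zeta>: "f = dilation \<zeta>" "\<zeta> ^ n = 1" by (auto simp: rotations_def)
      have "f ` B \<subseteq> B" if "B \<in> \<O>" for B
        using orb[OF that] by (auto simp: \<zeta> moebius_def power_mult_distrib)
      then have "f ` \<alpha> \<subseteq> \<alpha>" unfolding \<O>(3) by blast
      then show "f \<in> carrier (set_aut_group \<alpha>)"
        using f rotations_subset[OF assms] fin by (intro mem_set_aut_groupI) auto
    qed
    then obtain N U where NU: "N \<subseteq> {Infty, Fin 0}" "finite U" "0 \<notin> U" "\<alpha> = sphere_roots n N U"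
      using rotation_invariant_normal_form[OF _ fin assms] by metis
    then show "\<exists>N U. N \<subseteq> {Infty, Fin 0} \<and> finite U \<and> 0 \<notin> U \<and> card N = \<nu> \<and> card U = k \<and> \<alpha> = sphere_roots n N U"
      using idx fixed[OF NU(1,3)] free[OF NU(1,3)]
      by (intro exI[of _ N] exI[of _ U]) (simp add: has_cyclic_index_def)
  next
    assume "\<exists>N U. N \<subseteq> {Infty, Fin 0} \<and> finite U \<and> 0 \<notin> U \<and> card N = \<nu> \<and> card U = k \<and> \<alpha> = sphere_roots n N U"
    then obtain N U where NU: "N \<subseteq> {Infty, Fin 0}" "finite U" "0 \<notin> U" "card N = \<nu>" "card U = k"
      "\<alpha> = sphere_roots n N U" by blast
    define \<O> where "\<O> = (\<lambda>x. {x}) ` N \<union> (\<lambda>u. Fin ` {w. w ^ n = u}) ` U"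
    have "Fin ` {w. w ^ n = u} \<in> rotation_orbits n" if "u \<in> U" for u
    proof -
      obtain z where z: "z ^ n = u" using nth_root_exists[OF assms] by blast
      moreover have "z \<noteq> 0" using z that NU(3) assms by (auto simp: power_0_left)
      ultimately show ?thesis
        using cyclic_orbit_eq[OF assms, of z] by (auto simp: rotation_orbits_eq)
    qed
    then have "\<O> \<subseteq> rotation_orbits n" using NU(1) by (auto simp: \<O>_def rotation_orbits_eq)
    moreover have "finite \<O>" using NU(2) finite_subset[OF NU(1)] by (simp add: \<O>_def)
    moreover have "\<alpha> = \<Union>\<O>" by (auto simp: NU(6) \<O>_def sphere_roots_def)
    ultimately show "has_cyclic_index n \<alpha> (\<nu>, k)"
      using fixed[OF NU(1,3)] free[OF NU(1,3)] NU by (auto simp: has_cyclic_index_def)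
  qed
qed

section \<open>Configurations with an extra symmetry\<close>

text \<open>
  The arithmetic condition that turns out to characterise the component indices \<open>(\<nu>, k)\<close> of sets whose
  symmetry group is cyclic of order \<open>n\<close>.
\<close>

definition realizable_index :: "nat \<Rightarrow> nat \<Rightarrow> nat \<Rightarrow> bool" where
  "realizable_index n \<nu> k \<longleftrightarrow> \<nu> \<le> 2 \<and> (k \<ge> 3 \<or> \<nu> = 1 \<and> (k = 2 \<or> k = 1 \<and> n \<ge> 4))"

text \<open>
  If \<open>w ^ n = u v\<close>, the map \<open>z \<mapsto> w / z\<close> exchanges the roots of \<open>u\<close> with those of \<open>v\<close> and exchanges
  the two poles. For \<open>u = v\<close> this covers a single orbit.
\<close>

lemma reciprocal_symmetry:
  assumes n: "n \<ge> 1" and nz: "u \<noteq> 0" "v \<noteq> 0" and N: "N = {} \<or> N = {Infty, Fin 0}"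
  shows "\<exists>f \<in> carrier moebius_group. f ` sphere_roots n N {u, v} \<subseteq> sphere_roots n N {u, v} \<and> f Infty \<noteq> Infty"
proof -
  let ?\<alpha> = "sphere_roots n N {u, v}"
  obtain w where w: "w ^ n = u * v" using nth_root_exists[OF n] by blast
  have "w \<noteq> 0" using w n nz by (auto simp: power_0_left)
  define f where "f = sphere_moebius 0 w 1 0"
  have "f \<in> carrier moebius_group"
    unfolding f_def using \<open>w \<noteq> 0\<close> by (intro sphere_moebius_in_carrier) simp
  moreover have "f ` ?\<alpha> \<subseteq> ?\<alpha>"
  proof
    fix y assume "y \<in> f ` ?\<alpha>"
    then obtain x where x: "x \<in> ?\<alpha>" "y = f x" by blast
    show "y \<in> ?\<alpha>"
    proof (cases "x \<in> N")
      case True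
      then show ?thesis using N x by (auto simp: f_def sphere_roots_def moebius_def)
    next
      case False
      then obtain z where z: "x = Fin z" "z ^ n \<in> {u, v}" using x by (auto simp: sphere_roots_def)
      then have "z \<noteq> 0" using nz n by auto
      moreover have "(w / z) ^ n \<in> {u, v}" using z w nz by (auto simp: power_divide)
      ultimately show ?thesis using x z by (simp add: f_def sphere_roots_def moebius_def)
    qed
  qed
  moreover have "f Infty \<noteq> Infty" by (simp add: f_def)
  ultimately show ?thesis by blast
qed

text \<open>
  For \<open>n = 2\<close> any permutation of the three points is realised by a Moebius transformation. For \<open>n = 3\<close>
  the four points are the vertices of a regular tetrahedron, whose rotation group is transitive on the
  vertices.
\<close>

lemma small_pyramid_symmetry_Infty:
  assumes n23: "n = 2 \<or> n = 3" and u0: "u \<noteq> 0"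
  shows "\<exists>f \<in> carrier moebius_group.
    f ` sphere_roots n {Infty} {u} \<subseteq> sphere_roots n {Infty} {u} \<and> f Infty \<noteq> Infty"
proof -
  let ?\<alpha> = "sphere_roots n {Infty} {u}"
  have n1: "n \<ge> 1" using n23 by auto
  obtain a where a: "a ^ n = u" using nth_root_exists[OF n1] by blast
  have a0: "a \<noteq> 0" using a u0 n1 by (auto simp: power_0_left)
  have roots: "z ^ n = u \<longleftrightarrow> z = a \<or> (n = 2 \<and> z = - a) \<or> (n = 3 \<and> z * z + z * a + a * a = 0)" for z
  proof (cases "n = 2")
    case True
    then show ?thesis using a by (auto simp: power2_eq_iff)
  next
    case False
    then have n3: "n = 3" using n23 by simp
    have "z ^ 3 - a ^ 3 = (z - a) * (z * z + z * a + a * a)"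
      by (simp add: power3_eq_cube algebra_simps)
    then have "z ^ 3 = a ^ 3 \<longleftrightarrow> z = a \<or> z * z + z * a + a * a = 0"
      by (metis eq_iff_diff_eq_0 mult_eq_0_iff)
    then show ?thesis using a n3 by simp
  qed
  \<comment> \<open>The map exchanges \<open>\<infinity>\<close> and \<open>a\<close>; the value of \<open>t\<close> makes it fix the remaining root
    \<open>- a\<close> if \<open>n = 2\<close>, and exchange the two remaining roots if \<open>n = 3\<close>.\<close>
  define t :: complex where "t = (if n = 2 then 3 else 2)"
  define f where "f = sphere_moebius a (t * a * a) 1 (- a)"
  have "f \<in> carrier moebius_group"
  proof -
    have "1 + t \<noteq> 0" by (auto simp: t_def)
    moreover have "a * (- a) - t * a * a * 1 = - ((1 + t) * (a * a))" by (simp add: algebra_simps)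
    ultimately show ?thesis unfolding f_def using a0 by (intro sphere_moebius_in_carrier) simp
  qed
  moreover have "f ` ?\<alpha> \<subseteq> ?\<alpha>"
  proof
    fix y assume "y \<in> f ` ?\<alpha>"
    then obtain x where x: "x \<in> ?\<alpha>" "y = f x" by blast
    show "y \<in> ?\<alpha>"
    proof (cases "x \<in> {Infty, Fin a}")
      case True
      then show ?thesis using x a by (auto simp: f_def sphere_roots_def)
    next
      case False
      then obtain z where z: "x = Fin z" "z ^ n = u" "z \<noteq> a" using x by (auto simp: sphere_roots_def)
      define r where "r = (a * z + t * a * a) / (z - a)"
      have r: "r * (z - a) = a * z + t * a * a" using z by (simp add: r_def)
      have "r ^ n = u"
      proof (cases "n = 2")
        case True
        then have "z = - a" using z roots by auto
        then have "r = - a" using True a0 by (simp add: r_def t_def field_simps)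
        then show ?thesis using True roots by blast
      next
        case False
        then have n3: "n = 3" using n23 by simp
        then have t3: "t = 2" and q: "z * z + z * a + a * a = 0"
          using z roots by (auto simp: t_def)
        have "(z - a) * (z - a) * (r * r + r * a + a * a) = 0"
          using r q t3 by algebra
        then show ?thesis using n3 z roots by simp
      qed
      moreover have "y = Fin r" using x z by (simp add: f_def r_def moebius_def)
      ultimately show ?thesis by (simp add: sphere_roots_def)
    qed
  qed
  moreover have "f Infty \<noteq> Infty" by (simp add: f_def)
  ultimately show ?thesis by blast
qed

text \<open>
  The apex \<open>0\<close> is reduced to the apex \<open>\<infinity>\<close> by conjugation with \<open>\<iota> z = 1 / z\<close>, which replaces \<open>u\<close> by
  \<open>1 / u\<close>.
\<close>

lemma small_pyramid_symmetry:
  assumes n23: "n = 2 \<or> n = 3" and u0: "u \<noteq> 0" and p: "p = Infty \<or> p = Fin 0"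
  shows "\<exists>f \<in> carrier moebius_group. f ` sphere_roots n {p} {u} \<subseteq> sphere_roots n {p} {u} \<and> f p \<noteq> p"
proof (cases "p = Infty")
  case False
  define \<iota> where "\<iota> = sphere_moebius 0 1 1 0"
  have \<iota>: "\<iota> \<in> carrier moebius_group" unfolding \<iota>_def by (rule sphere_moebius_in_carrier) simp
  have \<iota>_values: "\<iota> Infty = Fin 0" "\<iota> (Fin 0) = Infty" "z \<noteq> 0 \<Longrightarrow> \<iota> (Fin z) = Fin (1 / z)" for z
    by (simp_all add: \<iota>_def moebius_def)
  have \<iota>\<iota>: "\<iota> (\<iota> x) = x" for x
  proof (cases x)
    case (Fin z)
    then show ?thesis by (cases "z = 0") (simp_all add: \<iota>_values)
  qed (simp add: \<iota>_values)
  have nz: "z \<noteq> 0" if "z ^ n = v" "v \<noteq> 0" for z v :: complex using that n23 by auto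
  have swap: "\<iota> ` sphere_roots n {q} {v} \<subseteq> sphere_roots n {\<iota> q} {1 / v}" if "v \<noteq> 0" for q v
    using nz[OF _ that] by (auto simp: sphere_roots_def \<iota>_values power_divide)
  obtain f where f: "f \<in> carrier moebius_group" "f Infty \<noteq> Infty"
    "f ` sphere_roots n {Infty} {1 / u} \<subseteq> sphere_roots n {Infty} {1 / u}"
    using small_pyramid_symmetry_Infty[OF n23, of "1 / u"] u0 by auto
  have p0: "p = Fin 0" using p False by simp
  have "(\<iota> \<circ> f \<circ> \<iota>) ` sphere_roots n {p} {u} \<subseteq> sphere_roots n {p} {u}"
    using swap[of u p] swap[of "1 / u" Infty] f(3) u0 unfolding p0 \<iota>_values image_comp[symmetric]
    by (simp add: \<iota>_values) blast
  moreover have "(\<iota> \<circ> f \<circ> \<iota>) p \<noteq> p" using f(2) \<iota>\<iota> p0 \<iota>_values by (metis comp_apply)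
  ultimately show ?thesis using \<iota> f(1) by (blast intro: moebius_comp_closed)
qed (use small_pyramid_symmetry_Infty[OF n23 u0] in simp)

text \<open>
  Every rotation fixes both poles and is a dilation by a number of modulus \<open>1\<close>, so a symmetry that
  moves a pole, or the dilation by \<open>2\<close>, shows that the symmetry group is larger.
\<close>

lemma rotation_group_forces_realizable:
  assumes aut: "carrier (set_aut_group (sphere_roots n N U)) = rotations n" and n: "n \<ge> 2"
    and N: "N \<subseteq> {Infty, Fin 0}" and U: "finite U" "0 \<notin> U"
  shows "realizable_index n (card N) (card U)"
proof -
  let ?\<alpha> = "sphere_roots n N U"
  have n1: "n \<ge> 1" using n by simp
  have fin: "finite ?\<alpha>" by (rule card_sphere_roots[OF n1 N U])
  have rot: "\<exists>\<zeta>. \<zeta> ^ n = 1 \<and> f = dilation \<zeta>" if "f \<in> carrier moebius_group" "f ` ?\<alpha> \<subseteq> ?\<alpha>" for f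
    using mem_set_aut_groupI[OF that(1) fin that(2)] aut by (auto simp: rotations_def)
  have fixed: "f p = p" if f: "f \<in> carrier moebius_group" "f ` ?\<alpha> \<subseteq> ?\<alpha>" and p: "p = Infty \<or> p = Fin 0" for f p
    using rot[OF f] p by (auto simp: moebius_def)
  have N_cases: "N = {} \<or> N = {Infty} \<or> N = {Fin 0} \<or> N = {Infty, Fin 0}" using N by auto
  have N2: "card N \<le> 2" using card_mono[of "{Infty, Fin 0}" N] N by simp
  have one_pole: "card N = 1" if "U = {u, v}" for u v
    using reciprocal_symmetry[OF n1, of u v N] fixed[of _ Infty] N_cases U(2) that by auto
  have not0: "card U \<noteq> 0"
  proof
    assume "card U = 0"
    then have "U = {}" using U by simp
    then have "dilation 2 ` ?\<alpha> \<subseteq> ?\<alpha>" using N by (auto simp: sphere_roots_def moebius_def)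
    then obtain \<zeta> :: complex where "\<zeta> ^ n = 1" "dilation 2 = dilation \<zeta>"
      using rot[of "dilation 2"] dilation_in_carrier[of 2] by auto
    then have "(2::complex) ^ n = 1" by (simp add: dilation_eq_iff)
    then have "norm ((2::complex) ^ n) = 1" by simp
    then have "(2::real) ^ n = 1" by (simp add: norm_power)
    then show False using one_less_power[of "2::real" n] n by simp
  qed
  have large: "n \<ge> 4" if cards: "card U = 1" "card N = 1"
  proof (rule ccontr)
    assume "\<not> n \<ge> 4"
    then have n23: "n = 2 \<or> n = 3" using n by auto
    obtain u where u: "U = {u}" using cards(1) by (rule card_1_singletonE)
    obtain p where p: "N = {p}" using cards(2) by (rule card_1_singletonE)
    then have p0: "p = Infty \<or> p = Fin 0" using N by auto
    have "u \<noteq> 0" using u U(2) by auto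
    then show False using small_pyramid_symmetry[OF n23 \<open>u \<noteq> 0\<close> p0] fixed[OF _ _ p0] u p by auto
  qed
  consider "card U \<ge> 3" | "card U = 2" | "card U = 1" using not0 by linarith
  then show ?thesis
  proof cases
    case 2
    then obtain u v where "U = {u, v}" by (auto simp: card_2_iff)
    then show ?thesis using 2 one_pole by (simp add: realizable_index_def)
  next
    case 3
    then obtain u where "U = {u, u}" by (metis card_1_singletonE insert_absorb2)
    then show ?thesis using 3 one_pole large by (auto simp: realizable_index_def)
  qed (simp add: realizable_index_def N2)
qed

section \<open>Moebius transformations preserving the unit circle\<close>

lemma quadratic_three_roots:
  fixes A B C :: complex
  assumes "x \<noteq> y" "y \<noteq> z" "x \<noteq> z"
    and "B * x\<^sup>2 + A * x + C = 0" "B * y\<^sup>2 + A * y + C = 0" "B * z\<^sup>2 + A * z + C = 0"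
  shows "A = 0" "B = 0"
proof -
  have "(x - y) * (B * (x + y) + A) = 0" "(y - z) * (B * (y + z) + A) = 0"
    using assms(4-6) by algebra+
  then have 1: "B * (x + y) + A = 0" "B * (y + z) + A = 0" using assms(1,2) by auto
  then have "B * (x - z) = 0" by algebra
  then show "B = 0" using assms(3) by simp
  then show "A = 0" using 1 by simp
qed

text \<open>
  For \<open>|w| = 1\<close>, the condition \<open>|a w + b|\<^sup>2 = |c w + d|\<^sup>2\<close>, multiplied by \<open>w\<close>, is a quadratic equation
  for \<open>w\<close> since \<open>w * cnj w = 1\<close>. With three solutions, all its coefficients vanish. The two resulting
  equations say that the matrix of the transformation preserves the Hermitian form
  \<open>|x|\<^sup>2 - |y|\<^sup>2\<close> up to a real factor, which is why such transformations are called unitary below.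
\<close>

lemma moebius_unit_circle_coefficients:
  assumes "norm x = 1" "norm y = 1" "norm z = 1" "x \<noteq> y" "y \<noteq> z" "x \<noteq> z"
    and "norm (a * x + b) = norm (c * x + d)" "norm (a * y + b) = norm (c * y + d)"
      "norm (a * z + b) = norm (c * z + d)"
  shows "a * cnj a + b * cnj b = c * cnj c + d * cnj d" "a * cnj b = c * cnj d"
proof -
  define A where "A = a * cnj a + b * cnj b - c * cnj c - d * cnj d"
  define B where "B = a * cnj b - c * cnj d"
  have quad: "B * w\<^sup>2 + A * w + cnj B = 0" if "norm w = 1" "norm (a * w + b) = norm (c * w + d)" for w
  proof -
    have w: "w * cnj w = 1" using that(1) by (simp add: complex_norm_square[symmetric])
    have "(a * w + b) * cnj (a * w + b) = (c * w + d) * cnj (c * w + d)"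
      using that(2) by (simp only: complex_norm_square[symmetric])
    then have "(a * w + b) * (cnj a * cnj w + cnj b) = (c * w + d) * (cnj c * cnj w + cnj d)" by simp
    then show ?thesis unfolding A_def B_def using w by simp algebra
  qed
  have "A = 0" "B = 0"
    using quadratic_three_roots[OF assms(4-6) quad quad quad] assms by blast+
  then show "a * cnj a + b * cnj b = c * cnj c + d * cnj d" "a * cnj b = c * cnj d"
    by (simp_all add: A_def B_def algebra_simps)
qed

context
  fixes a b c d :: complex
  assumes D: "a * d - b * c \<noteq> 0"
    and sum_eq: "a * cnj a + b * cnj b = c * cnj c + d * cnj d"
    and mixed_eq: "a * cnj b = c * cnj d"
begin

lemma unitary_moebius_circle:
  assumes "norm z = 1" shows "norm (a * z + b) = norm (c * z + d)"
proof -
  have z: "z * cnj z = 1" using assms by (simp add: complex_norm_square[symmetric])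
  have mixed': "cnj a * b = cnj c * d" using arg_cong[OF mixed_eq, of cnj] by simp
  have "(a * z + b) * (cnj a * cnj z + cnj b) = (c * z + d) * (cnj c * cnj z + cnj d)"
    using z sum_eq mixed_eq mixed' by algebra
  then have "(a * z + b) * cnj (a * z + b) = (c * z + d) * cnj (c * z + d)" by simp
  then have "complex_of_real ((norm (a * z + b))\<^sup>2) = of_real ((norm (c * z + d))\<^sup>2)"
    by (simp only: complex_norm_square)
  then show ?thesis by (simp only: of_real_eq_iff power2_eq_iff_nonneg norm_ge_zero)
qed

lemma unitary_moebius_denominator:
  assumes "norm z = 1" shows "c * z + d \<noteq> 0"
proof
  assume 0: "c * z + d = 0"
  then have "a * z + b = 0" using unitary_moebius_circle[OF assms] by simp
  then have "a * d - b * c = 0" using 0 by algebra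
  then show False using D by simp
qed

text \<open>
  Taking norms, \<open>{|a|\<^sup>2, |b|\<^sup>2}\<close> and \<open>{|c|\<^sup>2, |d|\<^sup>2}\<close> have the same sum and the same product, so they
  coincide. The possibility \<open>|a| = |c|\<close> is ruled out by
  \<open>|a d - b c|\<^sup>2 = (|a|\<^sup>2 - |c|\<^sup>2) (|d|\<^sup>2 - |b|\<^sup>2)\<close>.
\<close>

lemma unitary_moebius_norms:
  shows "norm a = norm d" "norm b = norm c" "norm (a * d - b * c) = \<bar>(norm d)\<^sup>2 - (norm c)\<^sup>2\<bar>"
proof -
  define x y s t where "x = (norm a)\<^sup>2" and "y = (norm b)\<^sup>2" and "s = (norm c)\<^sup>2" and "t = (norm d)\<^sup>2"
  have cx: "of_real x = a * cnj a" "of_real y = b * cnj b" "of_real s = c * cnj c" "of_real t = d * cnj d"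
    by (simp_all only: x_def y_def s_def t_def complex_norm_square)
  have mixed': "cnj a * b = cnj c * d" using arg_cong[OF mixed_eq, of cnj] by simp
  have "complex_of_real (x + y) = of_real (s + t)" by (simp add: cx sum_eq)
  then have 1: "x + y = s + t" by (simp only: of_real_eq_iff)
  have "norm (a * cnj b) = norm (c * cnj d)" by (simp only: mixed_eq)
  then have 2: "x * y = s * t"
    by (simp add: norm_mult x_def y_def s_def t_def flip: power_mult_distrib)
  have "complex_of_real ((norm (a * d - b * c))\<^sup>2) = (a * d - b * c) * cnj (a * d - b * c)"
    by (rule complex_norm_square)
  also have "\<dots> = (a * d - b * c) * (cnj a * cnj d - cnj b * cnj c)" by simp
  also have "\<dots> = of_real ((x - s) * (t - y))"
    unfolding of_real_mult of_real_diff cx using mixed_eq mixed' by algebra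
  finally have det: "(norm (a * d - b * c))\<^sup>2 = (x - s) * (t - y)" by (simp only: of_real_eq_iff)
  have "x \<noteq> s" using det D by auto
  moreover have "(x - s) * (x - t) = 0" using 1 2 by algebra
  ultimately have xt: "x = t" by simp
  then have ys: "y = s" using 1 by simp
  show "norm a = norm d" using xt by (simp add: x_def t_def)
  show "norm b = norm c" using ys by (simp add: y_def s_def)
  have "(norm (a * d - b * c))\<^sup>2 = (t - s)\<^sup>2" using det xt ys by (simp add: power2_eq_square)
  then have "\<bar>norm (a * d - b * c)\<bar> = \<bar>t - s\<bar>" by (simp only: power2_eq_iff abs_eq_iff)
  then show "norm (a * d - b * c) = \<bar>(norm d)\<^sup>2 - (norm c)\<^sup>2\<bar>" by (simp add: t_def s_def)
qed

end

text \<open>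
  With \<open>D = a d - b c\<close>, a Moebius transformation \<open>f\<close> satisfies
  \<open>f w - f v = D (w - v) / ((c w + d) (c v + d))\<close>. If \<open>f\<close> permutes \<open>S\<close>, the product of
  \<open>|f w - f v|\<close> over all ordered pairs of distinct points is the product of \<open>|w - v|\<close>, so the correction
  factors multiply to \<open>1\<close>. Each \<open>|c w + d|\<close> occurs in \<open>2 (|S| - 1)\<close> of them, and extracting the
  \<open>(|S| - 1)\<close>-th root gives the claim.
\<close>

lemma moebius_permutation_discriminant:
  fixes a b c d :: complex
  assumes D: "a * d - b * c \<noteq> 0" and S: "finite S" "card S \<ge> 2"
    and den: "\<And>w. w \<in> S \<Longrightarrow> c * w + d \<noteq> 0"
    and bij: "bij_betw (moebius a b c d) S S"
  shows "(\<Prod>w\<in>S. norm (c * w + d))\<^sup>2 = norm (a * d - b * c) ^ card S"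
proof -
  define m where "m = card S"
  define \<delta> where "\<delta> = norm (a * d - b * c)"
  define q where "q w = norm (c * w + d)" for w
  define Q where "Q = (\<Prod>w\<in>S. q w)"
  define f where "f = moebius a b c d"
  have q_pos: "q w > 0" if "w \<in> S" for w using den[OF that] by (simp add: q_def)
  then have Q_pos: "Q > 0" unfolding Q_def by (intro prod_pos) auto
  have \<delta>_pos: "\<delta> > 0" using D by (simp add: \<delta>_def)
  define V where "V = (\<Prod>w\<in>S. \<Prod>v\<in>S-{w}. norm (w - v))"
  have "V > 0" unfolding V_def by (intro prod_pos) auto
  have diff: "norm (f w - f v) * (q w * q v) = \<delta> * norm (w - v)" if "w \<in> S" "v \<in> S" for w v
  proof -
    have "(f w - f v) * ((c * w + d) * (c * v + d)) = (a * d - b * c) * (w - v)"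
    proof -
      have "f w * (c * w + d) = a * w + b" "f v * (c * v + d) = a * v + b"
        using den[OF that(1)] den[OF that(2)] by (simp_all add: f_def moebius_def)
      then show ?thesis by algebra
    qed
    then have "norm ((f w - f v) * ((c * w + d) * (c * v + d))) = norm ((a * d - b * c) * (w - v))"
      by (rule arg_cong)
    then show ?thesis unfolding \<delta>_def q_def by (simp only: norm_mult)
  qed
  have inj: "inj_on f S" and im: "f ` S = S" using bij by (auto simp: bij_betw_def f_def)
  have V_perm: "V = (\<Prod>w\<in>S. \<Prod>v\<in>S-{w}. norm (f w - f v))"
  proof -
    have "V = (\<Prod>w\<in>f ` S. \<Prod>v\<in>S-{w}. norm (w - v))" by (simp add: im V_def)
    also have "\<dots> = (\<Prod>w\<in>S. \<Prod>v\<in>S-{f w}. norm (f w - v))"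
      using inj by (simp add: prod.reindex)
    also have "\<dots> = (\<Prod>w\<in>S. \<Prod>v\<in>S-{w}. norm (f w - f v))"
    proof (rule prod.cong)
      fix w assume "w \<in> S"
      then have "S - {f w} = f ` (S - {w})" using inj im by (auto simp: inj_on_def)
      moreover have "inj_on f (S - {w})" using inj by (rule inj_on_diff)
      ultimately show "(\<Prod>v\<in>S-{f w}. norm (f w - v)) = (\<Prod>v\<in>S-{w}. norm (f w - f v))"
        by (simp add: prod.reindex)
    qed simp
    finally show ?thesis .
  qed
  have inner: "(\<Prod>v\<in>S-{w}. q w * q v) = q w ^ (m - 2) * Q" if "w \<in> S" for w
  proof -
    have "(\<Prod>v\<in>S-{w}. q w * q v) = q w ^ (m - 1) * (\<Prod>v\<in>S-{w}. q v)"
      using that S by (simp add: prod.distrib m_def)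
    also have "q w ^ (m - 1) = q w ^ (m - 2) * q w"
    proof -
      have "m - 1 = Suc (m - 2)" using S by (simp add: m_def)
      then show ?thesis by simp
    qed
    also have "q w ^ (m - 2) * q w * (\<Prod>v\<in>S-{w}. q v) = q w ^ (m - 2) * Q"
      using that S by (simp add: Q_def prod.remove)
    finally show ?thesis .
  qed
  have "V * Q ^ (2 * (m - 1)) = V * (\<Prod>w\<in>S. \<Prod>v\<in>S-{w}. q w * q v)"
  proof -
    have "(\<Prod>w\<in>S. \<Prod>v\<in>S-{w}. q w * q v) = (\<Prod>w\<in>S. q w ^ (m - 2) * Q)"
      by (intro prod.cong inner refl)
    also have "\<dots> = Q ^ (m - 2) * Q ^ m"
      by (simp add: prod.distrib m_def Q_def prod_power_distrib)
    also have "\<dots> = Q ^ (2 * (m - 1))"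
    proof -
      have "m - 2 + m = 2 * (m - 1)" using S by (simp add: m_def)
      then show ?thesis by (simp flip: power_add)
    qed
    finally show ?thesis by simp
  qed
  also have "\<dots> = (\<Prod>w\<in>S. \<Prod>v\<in>S-{w}. norm (f w - f v) * (q w * q v))"
    by (simp add: V_perm prod.distrib)
  also have "\<dots> = (\<Prod>w\<in>S. \<Prod>v\<in>S-{w}. \<delta> * norm (w - v))"
    using diff by (intro prod.cong refl) auto
  also have "\<dots> = (\<Prod>w\<in>S. \<delta> ^ (m - 1)) * V"
    using S by (simp add: prod.distrib V_def m_def)
  also have "\<dots> = V * (\<delta> ^ m) ^ (m - 1)"
    by (simp add: m_def mult.commute flip: power_mult)
  finally have "(Q\<^sup>2) ^ (m - 1) = (\<delta> ^ m) ^ (m - 1)"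
    using \<open>V > 0\<close> by (simp add: power_mult)
  then have "Q\<^sup>2 = \<delta> ^ m"
    using S Q_pos \<delta>_pos by (subst (asm) power_eq_iff_eq_base) (auto simp: m_def)
  then show ?thesis by (simp add: Q_def q_def \<delta>_def m_def)
qed

text \<open>
  For \<open>u \<noteq> 0\<close> the polynomial \<open>X ^ n - u\<close> has only simple roots, hence splits into the linear factors
  \<open>X - w\<close>.
\<close>

lemma prod_diff_nth_roots:
  fixes u x :: complex
  assumes "n \<ge> 1" "u \<noteq> 0"
  shows "(\<Prod>w | w ^ n = u. x - w) = x ^ n - u"
proof -
  define p where "p = Polynomial.monom 1 n + [:- u:]"
  have poly_p: "poly p y = y ^ n - u" for y by (simp add: p_def poly_monom)
  have deg: "degree p = n" and lead: "lead_coeff p = 1"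
  proof -
    have "degree [:- u:] < degree (Polynomial.monom (1::complex) n)" using assms by (simp add: degree_monom_eq)
    from degree_add_eq_left[OF this] show "degree p = n" by (simp add: p_def degree_monom_eq)
    then show "lead_coeff p = 1" using assms by (simp add: p_def coeff_pCons split: nat.split)
  qed
  have "rsquarefree p"
    unfolding rsquarefree_roots
  proof (intro allI notI)
    fix y assume y: "poly p y = 0 \<and> poly (pderiv p) y = 0"
    have "pderiv p = Polynomial.monom (of_nat n) (n - 1)"
      by (simp add: p_def pderiv_add pderiv_monom pderiv_pCons)
    then have "y = 0" using y assms by (auto simp: poly_monom)
    then show False using y assms by (simp add: poly_p power_0_left)
  qed
  from complex_poly_decompose_rsquarefree[OF this]
  have "p = (\<Prod>w | w ^ n = u. [:- w, 1:])" by (simp add: lead poly_p)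
  then have "poly p x = (\<Prod>w | w ^ n = u. x - w)" by (simp add: poly_prod)
  then show ?thesis by (simp add: poly_p)
qed

lemma prod_linear_over_roots:
  fixes c d :: complex
  assumes "n \<ge> 1" "finite U" "0 \<notin> U"
  shows "(\<Prod>w | w ^ n \<in> U. c * w + d) = (\<Prod>u\<in>U. d ^ n - (- c) ^ n * u)"
proof -
  have single: "(\<Prod>w | w ^ n = u. c * w + d) = d ^ n - (- c) ^ n * u" if "u \<noteq> 0" for u :: complex
  proof (cases "c = 0")
    case True
    then show ?thesis using card_nth_roots[OF that, of n] assms by (simp add: power_0_left)
  next
    case False
    have "(\<Prod>w | w ^ n = u. c * w + d) = (\<Prod>w | w ^ n = u. (- c) * (- d / c - w))"
      using False by (intro prod.cong refl) (simp add: field_simps)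
    also have "\<dots> = (- c) ^ n * ((- d / c) ^ n - u)"
      using card_nth_roots[OF that, of n] assms prod_diff_nth_roots[OF assms(1) that]
      by (simp only: prod.distrib prod_constant)
    also have "\<dots> = ((- c) * (- d / c)) ^ n - (- c) ^ n * u"
      by (simp only: power_mult_distrib right_diff_distrib)
    finally show ?thesis using False by simp
  qed
  have "{w. w ^ n \<in> U} = (\<Union>u\<in>U. {w. w ^ n = u})" by auto
  then have "(\<Prod>w | w ^ n \<in> U. c * w + d) = (\<Prod>u\<in>U. \<Prod>w | w ^ n = u. c * w + d)"
    using assms by (simp only:) (intro prod.UNION_disjoint; auto)
  also have "\<dots> = (\<Prod>u\<in>U. d ^ n - (- c) ^ n * u)"
    using assms(3) by (intro prod.cong refl single) auto
  finally show ?thesis .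
qed

text \<open>
  After division by the larger number this is \<open>(1 - r\<^sup>2) ^ n \<le> (1 - r\<^sup>2)\<^sup>2 \<le> (1 - r ^ n)\<^sup>2\<close> for
  \<open>0 \<le> r \<le> 1\<close>.
\<close>

lemma power_diff_squares_le:
  fixes x y :: real
  assumes "x \<ge> 0" "y \<ge> 0" "n \<ge> 2"
  shows "\<bar>x\<^sup>2 - y\<^sup>2\<bar> ^ n \<le> (x ^ n - y ^ n)\<^sup>2"
proof -
  have ordered: "\<bar>x\<^sup>2 - y\<^sup>2\<bar> ^ n \<le> (x ^ n - y ^ n)\<^sup>2" if "0 \<le> y" "y \<le> x" "x > 0" for x y :: real
  proof -
    define r where "r = y / x"
    have r: "0 \<le> r" "r \<le> 1" "y = r * x" using that by (auto simp: r_def)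
    have "r\<^sup>2 \<le> 1" using r by (simp add: power_le_one)
    have "(1 - r\<^sup>2) ^ n \<le> (1 - r\<^sup>2)\<^sup>2"
      using \<open>r\<^sup>2 \<le> 1\<close> r assms(3) by (intro power_decreasing) auto
    also have "\<dots> \<le> (1 - r ^ n)\<^sup>2"
      using \<open>r\<^sup>2 \<le> 1\<close> r assms(3) by (intro power_mono diff_left_mono power_decreasing) auto
    finally have le: "(1 - r\<^sup>2) ^ n \<le> (1 - r ^ n)\<^sup>2" .
    have "x\<^sup>2 - y\<^sup>2 = x\<^sup>2 * (1 - r\<^sup>2)" by (simp add: r(3) power_mult_distrib algebra_simps)
    moreover have "\<dots> \<ge> 0" using \<open>r\<^sup>2 \<le> 1\<close> by simp
    ultimately have "\<bar>x\<^sup>2 - y\<^sup>2\<bar> ^ n = (x\<^sup>2) ^ n * (1 - r\<^sup>2) ^ n" by (simp add: power_mult_distrib)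
    also have "\<dots> \<le> (x\<^sup>2) ^ n * (1 - r ^ n)\<^sup>2" using le by (intro mult_left_mono) auto
    also have "\<dots> = (x ^ n * (1 - r ^ n))\<^sup>2"
      by (simp add: power_mult_distrib mult.commute flip: power_mult)
    also have "x ^ n * (1 - r ^ n) = x ^ n - y ^ n" by (simp add: r(3) power_mult_distrib algebra_simps)
    finally show ?thesis .
  qed
  consider "x = 0" "y = 0" | "y \<le> x" "x > 0" | "x \<le> y" "y > 0" using assms by linarith
  then show ?thesis
  proof cases
    case 3
    then show ?thesis using ordered[of x y] assms by (simp add: abs_minus_commute power2_commute)
  qed (use ordered assms in \<open>auto simp: power_0_left\<close>)
qed

text \<open>
  Equality in the reverse triangle inequality for \<open>p - q u\<close> means that \<open>p\<close> and \<open>q u\<close> have the same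
  direction, and this determines \<open>u\<close>.
\<close>

lemma norm_diff_eq_determines_direction:
  fixes p q u v :: complex
  assumes "norm u = 1" "norm v = 1" "p \<noteq> 0" "q \<noteq> 0"
    and "norm (p - q * u) = \<bar>norm p - norm q\<bar>" "norm (p - q * v) = \<bar>norm p - norm q\<bar>"
  shows "u = v"
proof -
  have key: "p * cnj (q * w) = of_real (norm p * norm q)"
    if "norm w = 1" "norm (p - q * w) = \<bar>norm p - norm q\<bar>" for w
  proof -
    have "(norm (p - r))\<^sup>2 = (norm p)\<^sup>2 + (norm r)\<^sup>2 - 2 * Re (p * cnj r)" for r
      unfolding cmod_power2 by (simp add: power2_eq_square algebra_simps)
    from this[of "q * w"]
    have "(norm (p - q * w))\<^sup>2 = (norm p)\<^sup>2 + (norm q)\<^sup>2 - 2 * Re (p * cnj (q * w))"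
      using that(1) by (simp add: norm_mult del: complex_cnj_mult)
    moreover have "(norm (p - q * w))\<^sup>2 = (norm p)\<^sup>2 + (norm q)\<^sup>2 - 2 * (norm p * norm q)"
      using that(2) by (simp add: power2_diff)
    ultimately have re: "Re (p * cnj (q * w)) = norm p * norm q" by simp
    have nm: "norm (p * cnj (q * w)) = norm p * norm q" using that(1) by (simp add: norm_mult)
    have "(Re (p * cnj (q * w)))\<^sup>2 + (Im (p * cnj (q * w)))\<^sup>2 = (norm p * norm q)\<^sup>2"
      unfolding cmod_power2[symmetric] nm ..
    then have "Im (p * cnj (q * w)) = 0" using re by simp
    then show ?thesis using re by (simp add: complex_eq_iff)
  qed
  have "p * cnj (q * u) = p * cnj (q * v)" using key assms by metis
  then show ?thesis using assms(3,4) by simp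
qed

text \<open>
  The discriminant identity equates the product of \<open>|d ^ n - (- c) ^ n u|\<^sup>2\<close> over \<open>u \<in> U\<close> with that
  of the constant \<open>|D| ^ n\<close>. The triangle inequality and \<open>power_diff_squares_le\<close> bound every factor
  from below by this constant, so every factor attains the bound. If \<open>c\<close> and \<open>d\<close> are both nonzero, the
  direction of \<open>u\<close> is then determined, which two different elements of \<open>U\<close> contradict.
  Geometrically, \<open>0\<close> is the conformal barycentre of the roots of \<open>U\<close>, and a symmetry respects the
  barycentre up to inversion in the circle.
\<close>

lemma unitary_moebius_permutation:
  assumes D: "a * d - b * c \<noteq> 0"
    and coeffs: "a * cnj a + b * cnj b = c * cnj c + d * cnj d" "a * cnj b = c * cnj d"
    and U: "finite U" "\<And>u. u \<in> U \<Longrightarrow> norm u = 1" "card U \<ge> 2" and n: "n \<ge> 2"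
    and bij: "bij_betw (moebius a b c d) {w. w ^ n \<in> U} {w. w ^ n \<in> U}"
  shows "c = 0 \<or> d = 0"
proof (rule ccontr)
  assume cd: "\<not> (c = 0 \<or> d = 0)"
  let ?S = "{w. w ^ n \<in> U}"
  define \<delta> where "\<delta> = norm (a * d - b * c)"
  have U0: "0 \<notin> U" using U(2) by force
  have finS: "finite ?S" and cardS: "card ?S = n * card U"
    using finite_roots_of_set[of n U] card_roots_of_set[of n U] U U0 n by auto
  have normS: "norm w = 1" if "w \<in> ?S" for w
  proof -
    have "norm w ^ n = 1" using that U(2) by (simp flip: norm_power)
    then show ?thesis using n power_eq_imp_eq_base[of "norm w" n 1] by simp
  qed
  have "n * card U \<ge> 2 * 2" using n U(3) by (intro mult_mono) auto
  then have "card ?S \<ge> 2" unfolding cardS by simp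
  then have "(\<Prod>w\<in>?S. norm (c * w + d))\<^sup>2 = \<delta> ^ (n * card U)"
    unfolding \<delta>_def cardS[symmetric]
    by (intro moebius_permutation_discriminant[OF D finS] bij unitary_moebius_denominator[OF D coeffs] normS)
  moreover have "(\<Prod>w\<in>?S. norm (c * w + d)) = (\<Prod>u\<in>U. norm (d ^ n - (- c) ^ n * u))"
    using prod_linear_over_roots[of n U c d] n U U0 by (simp add: prod_norm)
  ultimately have prod_eq: "(\<Prod>u\<in>U. (norm (d ^ n - (- c) ^ n * u))\<^sup>2) = (\<Prod>u\<in>U. \<delta> ^ n)"
    by (simp add: prod_power_distrib power_mult)
  define \<rho> where "\<rho> = \<bar>norm (d ^ n) - norm ((- c) ^ n)\<bar>"
  have \<delta>: "\<delta> = \<bar>(norm d)\<^sup>2 - (norm c)\<^sup>2\<bar>"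
    unfolding \<delta>_def by (rule unitary_moebius_norms[OF D coeffs])
  have "\<delta> ^ n > 0" using D by (simp add: \<delta>_def)
  have low: "\<delta> ^ n \<le> \<rho>\<^sup>2"
    unfolding \<delta> \<rho>_def using power_diff_squares_le[of "norm d" "norm c" n] n by (simp add: norm_power)
  have tri: "\<rho> \<le> norm (d ^ n - (- c) ^ n * u)" if "u \<in> U" for u
    using norm_triangle_ineq3[of "d ^ n" "(- c) ^ n * u"] U(2)[OF that] by (simp add: \<rho>_def norm_mult)
  have tri2: "\<rho>\<^sup>2 \<le> (norm (d ^ n - (- c) ^ n * u))\<^sup>2" if "u \<in> U" for u
    using tri[OF that] by (intro power_mono) (auto simp: \<rho>_def)
  have eq: "norm (d ^ n - (- c) ^ n * u) = \<rho>" if u: "u \<in> U" for u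
  proof (rule ccontr)
    assume "norm (d ^ n - (- c) ^ n * u) \<noteq> \<rho>"
    then have "\<rho> < norm (d ^ n - (- c) ^ n * u)" using tri[OF u] by simp
    then have "\<rho>\<^sup>2 < (norm (d ^ n - (- c) ^ n * u))\<^sup>2" by (intro power_strict_mono) (auto simp: \<rho>_def)
    then have strict: "\<delta> ^ n < (norm (d ^ n - (- c) ^ n * u))\<^sup>2" using low by simp
    have "(\<Prod>u\<in>U. \<delta> ^ n) = \<delta> ^ n * (\<Prod>v\<in>U-{u}. \<delta> ^ n)" using U u by (simp only: prod.remove)
    also have "\<dots> < (norm (d ^ n - (- c) ^ n * u))\<^sup>2 * (\<Prod>v\<in>U-{u}. \<delta> ^ n)"
      using strict \<open>\<delta> ^ n > 0\<close> by (intro mult_strict_right_mono prod_pos) auto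
    also have "\<dots> \<le> (norm (d ^ n - (- c) ^ n * u))\<^sup>2 * (\<Prod>v\<in>U-{u}. (norm (d ^ n - (- c) ^ n * v))\<^sup>2)"
    proof (intro mult_left_mono prod_mono conjI)
      fix v assume "v \<in> U - {u}"
      then show "\<delta> ^ n \<le> (norm (d ^ n - (- c) ^ n * v))\<^sup>2" using low tri2[of v] by simp
    qed (use \<open>\<delta> ^ n > 0\<close> in auto)
    also have "\<dots> = (\<Prod>v\<in>U. (norm (d ^ n - (- c) ^ n * v))\<^sup>2)" using U u by (simp only: prod.remove)
    finally show False using prod_eq by simp
  qed
  obtain V where "V \<subseteq> U" "card V = 2" using U(3) by (rule obtain_subset_with_card_n)
  then obtain u v where uv: "u \<in> U" "v \<in> U" "u \<noteq> v" by (auto simp: card_2_iff)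
  have "u = v"
    using norm_diff_eq_determines_direction[of u v "d ^ n" "(- c) ^ n"] eq uv U(2) cd by (simp add: \<rho>_def)
  then show False using uv by simp
qed

section \<open>Chiral configurations on the circle\<close>

text \<open>
  The angles \<open>1, 1/2, 1/3, \<dots>\<close> all lie in an arc shorter than a quarter of the circle, which excludes
  rotations, and the largest is so far from the others that, with at least three points, no reflection is
  possible. Apart from this the choice is arbitrary.
\<close>

definition chiral_points :: "nat \<Rightarrow> complex set" where
  "chiral_points k = (\<lambda>j. cis (1 / (real j + 1))) ` {..<k}"

lemma cis_inj_0_2:
  assumes "cis s = cis t" "0 \<le> s" "s \<le> 2" "0 \<le> t" "t \<le> 2" shows "s = t"
proof -
  have "cos s = cos t" using arg_cong[OF assms(1), of Re] by simp
  moreover have "s \<le> pi" "t \<le> pi" using assms pi_ge_two by auto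
  ultimately show ?thesis using assms cos_inj_pi by blast
qed

lemma chiral_points_basic:
  shows "finite (chiral_points k)" "u \<in> chiral_points k \<Longrightarrow> norm u = 1" "card (chiral_points k) = k"
    "0 \<notin> chiral_points k"
proof -
  have "inj_on (\<lambda>j. cis (1 / (real j + 1))) {..<k}"
  proof (rule inj_onI)
    fix i j assume "cis (1 / (real i + 1)) = cis (1 / (real j + 1))"
    then have "1 / (real i + 1) = 1 / (real j + 1)" by (rule cis_inj_0_2) (auto simp: field_simps)
    then show "i = j" by simp
  qed
  then show "card (chiral_points k) = k" by (simp add: chiral_points_def card_image)
qed (auto simp: chiral_points_def)

text \<open>
  A rotation that preserves the set preserves the sum of its elements, which is not \<open>0\<close> because all
  elements have positive real part.
\<close>

lemma chiral_points_no_rotation: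
  assumes "k \<ge> 1" "\<gamma> \<noteq> 0" "\<And>u. u \<in> chiral_points k \<Longrightarrow> \<gamma> * u \<in> chiral_points k"
  shows "\<gamma> = 1"
proof -
  let ?U = "chiral_points k"
  have inj: "inj_on ((*) \<gamma>) ?U" using assms(2) by (auto simp: inj_on_def)
  then have im: "(*) \<gamma> ` ?U = ?U"
    using assms(3) by (intro endo_inj_surj chiral_points_basic) auto
  have "\<Sum>?U = \<Sum>((*) \<gamma> ` ?U)" by (simp add: im)
  also have "\<dots> = \<gamma> * \<Sum>?U" using inj by (simp add: sum.reindex sum_distrib_left)
  finally have eq: "\<Sum>?U = \<gamma> * \<Sum>?U" .
  have "Re u > 0" if "u \<in> ?U" for u
  proof -
    obtain j where j: "u = cis (1 / (real j + 1))" using \<open>u \<in> ?U\<close> by (auto simp: chiral_points_def)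
    have "1 / (real j + 1) < pi / 2"
      by (rule le_less_trans[of _ 1]) (use pi_gt3 in auto)
    moreover have "1 / (real j + 1) > - (pi / 2)"
      by (rule less_le_trans[of _ 0]) auto
    ultimately show ?thesis using j cos_gt_zero_pi by simp
  qed
  moreover have "?U \<noteq> {}" using assms(1) chiral_points_basic(3)[of k] by auto
  ultimately have "Re (\<Sum>?U) > 0"
    by (simp add: sum_pos chiral_points_basic)
  then have "\<Sum>?U \<noteq> 0" by (metis less_irrefl zero_complex.sel(1))
  then show ?thesis using eq by simp
qed

text \<open>
  On the unit circle \<open>u \<mapsto> \<gamma> / u\<close> is a reflection. If it preserved the set, the angle \<open>t j\<close> of each
  point and the angle \<open>t m\<close> of its image would add up to the angle of \<open>\<gamma>\<close>. As \<open>t 0 = 1\<close>, this angle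
  exceeds \<open>1\<close>, and two angles that are at most \<open>1/2\<close> are too small to add up to it. Hence the image of
  the second point is the first one, the angle of \<open>\<gamma>\<close> is \<open>3/2\<close>, and the image of the third point would
  have the angle \<open>7/6\<close>.
\<close>

lemma chiral_points_no_reflection:
  assumes "k \<ge> 3" shows "\<exists>u \<in> chiral_points k. \<gamma> / u \<notin> chiral_points k"
proof (rule ccontr)
  assume contra: "\<not> ?thesis"
  define t where "t j = 1 / (real j + 1)" for j :: nat
  have t_range: "0 < t j" "t j \<le> 1" for j by (auto simp: t_def)
  have t_half: "t j \<le> 1 / 2" if "j \<noteq> 0" for j using that by (simp add: t_def field_simps)
  have partner: "\<exists>m. \<gamma> = cis (t j + t m)" if "j < k" for j
  proof -
    have "cis (t j) \<in> chiral_points k" using that by (auto simp: chiral_points_def t_def)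
    then have "\<gamma> / cis (t j) \<in> chiral_points k" using contra by blast
    then obtain m where "\<gamma> / cis (t j) = cis (t m)" by (auto simp: chiral_points_def t_def)
    then have "\<gamma> = cis (t j + t m)" by (simp add: field_simps flip: cis_mult)
    then show ?thesis ..
  qed
  obtain m0 where m0: "\<gamma> = cis (t 0 + t m0)" using partner[of 0] assms by auto
  obtain m1 where m1: "\<gamma> = cis (t 1 + t m1)" using partner[of 1] assms by auto
  obtain m2 where m2: "\<gamma> = cis (t 2 + t m2)" using partner[of 2] assms by auto
  have rng: "0 \<le> t i + t j" "t i + t j \<le> 2" for i j
    using t_range[of i] t_range[of j] by auto
  \<comment> \<open>All sums of two angles lie in \<open>[0, 2]\<close>, where \<open>cis\<close> is injective.\<close>
  have "t 0 + t m0 = t 1 + t m1" "t 0 + t m0 = t 2 + t m2"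
    by (rule cis_inj_0_2; use m0 m1 m2 rng in simp)+
  moreover have "t 0 = 1" "t 1 = 1 / 2" "t 2 = 1 / 3" by (simp_all add: t_def)
  ultimately have "1 / 2 < t m1" "t m2 = t m1 + 1 / 6"
    using t_range(1)[of m0] by linarith+
  then have "m1 = 0" using t_half[of m1] by force
  then show False using \<open>t m2 = t m1 + 1 / 6\<close> \<open>t 0 = 1\<close> t_range(2)[of m2] by simp
qed

text \<open>
  At most \<open>|N|\<close> points of the circle are sent to poles. The index condition leaves at least three points
  of the circle with image on the circle, so \<open>f\<close> preserves the circle and therefore maps \<open>N\<close> to itself.
  Then \<open>f\<close> permutes \<open>\<infinity>\<close> and \<open>0\<close>, by the coefficient equations if a pole is in \<open>N\<close> and by
  \<open>unitary_moebius_permutation\<close> if \<open>N\<close> is empty. For \<open>k \<le> 2\<close> the index condition makes \<open>N\<close> a single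
  pole, fixed by \<open>f\<close>, so that the maps \<open>z \<mapsto> p / z\<close> occur only for \<open>k \<ge> 3\<close>.
\<close>

lemma rotation_group_of_chiral_configuration:
  assumes n: "n \<ge> 2" and N: "N \<in> {{}, {Infty}, {Infty, Fin 0}}"
    and real: "realizable_index n (card N) k"
  shows "carrier (set_aut_group (sphere_roots n N (chiral_points k))) = rotations n"
proof (rule antisym)
  let ?U = "chiral_points k"
  let ?C = "{w. w ^ n \<in> ?U}"
  let ?F = "Fin ` ?C"
  let ?\<alpha> = "sphere_roots n N ?U"
  have n1: "n \<ge> 1" using n by simp
  have N': "N \<subseteq> {Infty, Fin 0}" and finN: "finite N" using N by auto
  note U = chiral_points_basic[where k = k]
  show "rotations n \<subseteq> carrier (set_aut_group ?\<alpha>)"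
    by (rule sphere_roots_rotation_invariant[OF n1 N' U(1,4)])
  have k1: "k \<ge> 1" using real by (auto simp: realizable_index_def)
  have cardC: "card ?C = n * k" and finC: "finite ?C"
    using card_roots_of_set[OF n1 U(1,4)] finite_roots_of_set[OF n1 U(1)] U(3) by auto
  have cardF: "card ?F = n * k" by (subst card_image) (auto simp: inj_on_def cardC)
  have normC: "norm w = 1" if "w \<in> ?C" for w
  proof -
    have "norm w ^ n = 1" using that U(2) by (simp flip: norm_power)
    then show ?thesis using n power_eq_imp_eq_base[of "norm w" n 1] by simp
  qed
  have disj: "N \<inter> ?F = {}" using N' normC by fastforce
  have \<alpha>: "?\<alpha> = N \<union> ?F" by (simp add: sphere_roots_def)
  have many: "n * k \<ge> card N + 3"
  proof -
    consider "k \<ge> 3" | "k = 2" "card N = 1" | "k = 1" "card N = 1" "n \<ge> 4"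
      using real by (auto simp: realizable_index_def)
    then show ?thesis
    proof cases
      case 1
      then have "2 * 3 \<le> n * k" using n by (intro mult_mono) auto
      then show ?thesis using real by (simp add: realizable_index_def)
    qed (use n in auto)
  qed
  show "carrier (set_aut_group ?\<alpha>) \<subseteq> rotations n"
  proof
    fix f assume "f \<in> carrier (set_aut_group ?\<alpha>)"
    then have f: "f \<in> carrier moebius_group" "f ` ?\<alpha> = ?\<alpha>" by (auto simp: mem_set_aut_group)
    have inj: "inj f" by (rule moebius_map_inj[OF f(1)])
    obtain a b c d where f_eq: "f = sphere_moebius a b c d" and D: "a * d - b * c \<noteq> 0"
      using f(1) by (rule moebius_map_cases)
    \<comment> \<open>the points of the circle that stay on the circle\<close>
    define T where "T = {w \<in> ?C. f (Fin w) \<in> ?F}"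
    have finT: "finite T" unfolding T_def by (rule finite_subset[OF _ finC]) auto
    have "card (?C - T) \<le> card N"
    proof (rule card_inj_on_le[of "\<lambda>w. f (Fin w)"])
      show "inj_on (\<lambda>w. f (Fin w)) (?C - T)" using inj by (auto simp: inj_on_def)
      show "(\<lambda>w. f (Fin w)) ` (?C - T) \<subseteq> N" using f(2) \<alpha> by (auto simp: T_def)
    qed (rule finN)
    moreover have "card (?C - T) = card ?C - card T"
      by (rule card_Diff_subset[OF finT]) (auto simp: T_def)
    ultimately have "card T \<ge> 3" using many cardC by simp
    then obtain R where "R \<subseteq> T" "card R = 3" by (rule obtain_subset_with_card_n)
    then obtain x y z where xyz: "x \<in> T" "y \<in> T" "z \<in> T" "x \<noteq> y" "y \<noteq> z" "x \<noteq> z"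
      by (auto simp: card_3_iff)
    have T: "norm w = 1 \<and> norm (a * w + b) = norm (c * w + d)" if wT: "w \<in> T" for w
    proof -
      obtain v where v: "v \<in> ?C" "f (Fin w) = Fin v" using wT by (auto simp: T_def)
      then have "c * w + d \<noteq> 0" "v = (a * w + b) / (c * w + d)"
        by (auto simp: f_eq moebius_def split: if_split_asm)
      moreover have "norm v = 1" using v normC by blast
      ultimately have "norm (a * w + b) = norm (c * w + d)" by (simp add: norm_divide)
      then show ?thesis using that normC by (auto simp: T_def)
    qed
    have coeffs: "a * cnj a + b * cnj b = c * cnj c + d * cnj d" "a * cnj b = c * cnj d"
      using moebius_unit_circle_coefficients[of x y z a b c d] T xyz by auto
    have f_C: "f (Fin w) = Fin (moebius a b c d w)" "moebius a b c d w \<in> ?C" if "w \<in> ?C" for w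
    proof -
      have nz: "c * w + d \<noteq> 0" by (rule unitary_moebius_denominator[OF D coeffs normC[OF that]])
      then show eq: "f (Fin w) = Fin (moebius a b c d w)" by (simp add: f_eq)
      have "norm (moebius a b c d w) = 1"
        using unitary_moebius_circle[OF D coeffs normC[OF that]] nz by (simp add: moebius_def norm_divide)
      moreover have "f (Fin w) \<in> N \<union> ?F" using f(2) \<alpha> that by auto
      ultimately show "moebius a b c d w \<in> ?C" using eq N' by auto
    qed
    have "f ` ?F \<subseteq> ?F" using f_C by auto
    then have fF: "f ` ?F = ?F"
      using inj finC by (intro endo_inj_surj) (auto intro: inj_on_subset)
    have "f ` N \<union> ?F = N \<union> ?F" using f(2) by (simp add: \<alpha> image_Un fF)
    moreover have "f ` N \<inter> ?F = {}" using disj inj fF by (metis image_Int image_empty)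
    ultimately have fN: "f ` N = N" using disj by blast
    have "b = 0 \<and> c = 0 \<or> a = 0 \<and> d = 0 \<and> k \<ge> 3"
    proof -
      consider "N = {}" | "f Infty = Infty" | "N = {Infty, Fin 0}" "f Infty = Fin 0"
        using N fN by auto
      then show ?thesis
      proof cases
        case 1
        then have k3: "k \<ge> 3" using real by (simp add: realizable_index_def)
        have "inj_on (moebius a b c d) ?C"
        proof (rule inj_onI)
          fix v w assume "v \<in> ?C" "w \<in> ?C" "moebius a b c d v = moebius a b c d w"
          then have "f (Fin v) = f (Fin w)" using f_C by simp
          then show "v = w" using inj by (simp add: inj_eq)
        qed
        moreover have "moebius a b c d ` ?C = ?C"
          using f_C(2) calculation by (intro endo_inj_surj[OF finC]) auto
        ultimately have "bij_betw (moebius a b c d) ?C ?C" by (simp add: bij_betw_def)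
        then have "c = 0 \<or> d = 0"
          using U k3 by (intro unitary_moebius_permutation[OF D coeffs _ _ _ n]) auto
        moreover have "norm a = norm d" "norm b = norm c" by (rule unitary_moebius_norms[OF D coeffs])+
        ultimately show ?thesis using k3 by auto
      next
        case 2
        then have "c = 0" by (simp add: f_eq split: if_split_asm)
        then show ?thesis using coeffs(2) D by auto
      next
        case 3
        then have "a = 0" "c \<noteq> 0" by (auto simp: f_eq split: if_split_asm)
        then show ?thesis using coeffs(2) 3 real by (auto simp: realizable_index_def)
      qed
    qed
    then show "f \<in> rotations n"
    proof (elim disjE conjE)
      assume bc: "b = 0" "c = 0"
      then have nz: "a \<noteq> 0" "d \<noteq> 0" using D by auto
      have "(a / d) ^ n * u \<in> ?U" if u: "u \<in> ?U" for u
      proof -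
        obtain w where w: "w ^ n = u" using nth_root_exists[OF n1] by blast
        then have "moebius a b c d w \<in> ?C" using u f_C(2)[of w] by simp
        moreover have "moebius a b c d w = a / d * w" by (simp add: moebius_def bc)
        ultimately have "(a / d * w) ^ n \<in> ?U" by (simp only: mem_Collect_eq)
        then show ?thesis by (simp only: power_mult_distrib w)
      qed
      then have "(a / d) ^ n = 1" using nz by (intro chiral_points_no_rotation[OF k1]) auto
      moreover have "f = dilation (a / d)"
        using sphere_moebius_scale[OF nz(2), of "a / d" 0 0 1] nz by (simp add: f_eq bc)
      ultimately show ?thesis by (simp add: rotations_def)
    next
      assume ad: "a = 0" "d = 0" "k \<ge> 3"
      have "(b / c) ^ n / u \<in> ?U" if u: "u \<in> ?U" for u
      proof -
        obtain w where w: "w ^ n = u" using nth_root_exists[OF n1] by blast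
        then have "moebius a b c d w \<in> ?C" using u f_C(2)[of w] by simp
        moreover have "moebius a b c d w = b / c / w" by (simp add: moebius_def ad)
        ultimately have "(b / c / w) ^ n \<in> ?U" by (simp only: mem_Collect_eq)
        then show ?thesis by (simp only: power_divide w)
      qed
      then show ?thesis using chiral_points_no_reflection[OF ad(3)] by blast
    qed
  qed
qed

section \<open>Component indices and cardinalities\<close>

text \<open>
  An index presupposes invariance under the \<open>n\<close> rotations, so a symmetry group of order \<open>n\<close> consists of
  exactly these. This is why no conjugation is necessary here, in contrast to the description of the
  cardinalities below, where the fixed points of the group may lie anywhere.
\<close>

lemma cyclic_index_realizable_iff:
  assumes "n \<ge> 2"
  shows "(\<exists>\<alpha>. finite \<alpha> \<and> set_aut_group \<alpha> \<cong> integer_mod_group n \<and> has_cyclic_index n \<alpha> (\<nu>, k)) \<longleftrightarrow>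
    realizable_index n \<nu> k"
proof
  have n1: "n \<ge> 1" using assms by simp
  assume "\<exists>\<alpha>. finite \<alpha> \<and> set_aut_group \<alpha> \<cong> integer_mod_group n \<and> has_cyclic_index n \<alpha> (\<nu>, k)"
  then obtain N U where iso: "set_aut_group (sphere_roots n N U) \<cong> integer_mod_group n"
    and NU: "N \<subseteq> {Infty, Fin 0}" "finite U" "0 \<notin> U" "card N = \<nu>" "card U = k"
    unfolding has_cyclic_index_iff[OF n1] by auto
  have sub: "rotations n \<subseteq> carrier (set_aut_group (sphere_roots n N U))"
    by (rule sphere_roots_rotation_invariant[OF n1 NU(1-3)])
  have "card (carrier (set_aut_group (sphere_roots n N U))) = n"
    using cyclic_set_aut_group_generator[OF iso assms] by metis
  then have "rotations n = carrier (set_aut_group (sphere_roots n N U))"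
    using sub card_rotations[OF n1] assms card.infinite
    by (intro card_subset_eq) (auto intro: ccontr)
  then show "realizable_index n \<nu> k"
    using rotation_group_forces_realizable[OF _ assms NU(1-3)] NU(4,5) by simp
next
  have n1: "n \<ge> 1" using assms by simp
  assume real: "realizable_index n \<nu> k"
  then have "\<nu> = 0 \<or> \<nu> = 1 \<or> \<nu> = 2" by (auto simp: realizable_index_def)
  then obtain N where N: "N \<in> {{}, {Infty}, {Infty, Fin 0}}" "card N = \<nu>"
    by (elim disjE) (use that[of "{}"] that[of "{Infty}"] that[of "{Infty, Fin 0}"] in auto)
  let ?\<alpha> = "sphere_roots n N (chiral_points k)"
  have N': "N \<subseteq> {Infty, Fin 0}" using N by auto
  have "carrier (set_aut_group ?\<alpha>) = rotations n"
    using rotation_group_of_chiral_configuration[OF assms N(1)] N(2) real by simp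
  then have "set_aut_group ?\<alpha> \<cong> integer_mod_group n" by (rule set_aut_group_iso_cyclic[OF _ n1])
  moreover have "finite ?\<alpha>" by (rule card_sphere_roots[OF n1 N' chiral_points_basic(1,4)])
  moreover have "has_cyclic_index n ?\<alpha> (\<nu>, k)"
    unfolding has_cyclic_index_iff[OF n1] using N N' chiral_points_basic[where k = k] by blast
  ultimately show "\<exists>\<alpha>. finite \<alpha> \<and> set_aut_group \<alpha> \<cong> integer_mod_group n \<and> has_cyclic_index n \<alpha> (\<nu>, k)"
    by blast
qed

lemma card_cyclic_index:
  assumes "n \<ge> 1" "has_cyclic_index n \<alpha> (\<nu>, k)" shows "card \<alpha> = \<nu> + n * k"
  using assms card_sphere_roots[OF assms(1)] unfolding has_cyclic_index_iff[OF assms(1)] by auto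

lemma cardinalities_with_cyclic_group:
  assumes "n \<ge> 2"
  shows "{card \<alpha> | \<alpha>. finite \<alpha> \<and> set_aut_group \<alpha> \<cong> integer_mod_group n} =
    {\<nu> + n * k | \<nu> k. realizable_index n \<nu> k}"
proof (intro equalityI subsetI)
  have n1: "n \<ge> 1" using assms by simp
  fix m assume "m \<in> {card \<alpha> | \<alpha>. finite \<alpha> \<and> set_aut_group \<alpha> \<cong> integer_mod_group n}"
  then obtain \<alpha> where \<alpha>: "m = card \<alpha>" "finite \<alpha>" "set_aut_group \<alpha> \<cong> integer_mod_group n" by blast
  obtain h where h: "h \<in> carrier moebius_group" "carrier (set_aut_group (h ` \<alpha>)) = rotations n"
    using conjugate_set_aut_group_to_rotations[OF \<alpha>(3) assms] by metis
  have card: "card (h ` \<alpha>) = m"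
    using \<alpha>(1) moebius_map_inj[OF h(1)] by (metis card_image inj_on_subset subset_UNIV)
  obtain N U where NU: "N \<subseteq> {Infty, Fin 0}" "finite U" "0 \<notin> U" "h ` \<alpha> = sphere_roots n N U"
    using rotation_invariant_normal_form[of n "h ` \<alpha>"] h(2) \<alpha>(2) n1 by auto
  have "realizable_index n (card N) (card U)"
    using rotation_group_forces_realizable[OF _ assms NU(1-3)] h(2) NU(4) by simp
  moreover have "m = card N + n * card U"
    using card card_sphere_roots(2)[OF n1 NU(1-3)] NU(4) by simp
  ultimately show "m \<in> {\<nu> + n * k | \<nu> k. realizable_index n \<nu> k}" by blast
next
  have n1: "n \<ge> 1" using assms by simp
  fix m assume "m \<in> {\<nu> + n * k | \<nu> k. realizable_index n \<nu> k}"
  then obtain \<nu> k where "m = \<nu> + n * k" "realizable_index n \<nu> k" by blast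
  then show "m \<in> {card \<alpha> | \<alpha>. finite \<alpha> \<and> set_aut_group \<alpha> \<cong> integer_mod_group n}"
    using cyclic_index_realizable_iff[OF assms, of \<nu> k] card_cyclic_index[OF n1] by force
qed

theorem theorem13:
  fixes n :: nat
  assumes "n \<ge> 2"
  shows
    "(n \<ge> 4 \<longrightarrow>
       (\<exists>\<alpha>. finite \<alpha> \<and> set_aut_group \<alpha> \<cong> integer_mod_group n \<and>
          has_cyclic_index n \<alpha> (1, 1) \<and> card \<alpha> = 1 + n) \<and>
       (\<exists>\<alpha>. finite \<alpha> \<and> set_aut_group \<alpha> \<cong> integer_mod_group n \<and>
          has_cyclic_index n \<alpha> (1, 2) \<and> card \<alpha> = 1 + 2 * n) \<and>
       (\<forall>\<nu> \<in> {0, 1, 2}. \<forall>k \<ge> 3.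
          \<exists>\<alpha>. finite \<alpha> \<and> set_aut_group \<alpha> \<cong> integer_mod_group n \<and>
            has_cyclic_index n \<alpha> (\<nu>, k) \<and> card \<alpha> = \<nu> + n * k) \<and>
       (\<forall>i \<in> {(0, 1), (0, 2), (2, 1), (2, 2)}.
          \<not> (\<exists>\<alpha>. finite \<alpha> \<and> set_aut_group \<alpha> \<cong> integer_mod_group n \<and> has_cyclic_index n \<alpha> i))) \<and>
     (n \<in> {2, 3} \<longrightarrow>
       (\<exists>\<alpha>. finite \<alpha> \<and> set_aut_group \<alpha> \<cong> integer_mod_group n \<and>
          has_cyclic_index n \<alpha> (1, 2) \<and> card \<alpha> = 1 + 2 * n) \<and>
       (\<forall>\<nu> \<in> {0, 1, 2}. \<forall>k \<ge> 3.
          \<exists>\<alpha>. finite \<alpha> \<and> set_aut_group \<alpha> \<cong> integer_mod_group n \<and>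
            has_cyclic_index n \<alpha> (\<nu>, k) \<and> card \<alpha> = \<nu> + n * k) \<and>
       (\<forall>i \<in> {(0, 1), (0, 2), (1, 1), (2, 1), (2, 2)}.
          \<not> (\<exists>\<alpha>. finite \<alpha> \<and> set_aut_group \<alpha> \<cong> integer_mod_group n \<and> has_cyclic_index n \<alpha> i))) \<and>
     (n \<ge> 4 \<longrightarrow>
       {card \<alpha> | \<alpha>. finite \<alpha> \<and> set_aut_group \<alpha> \<cong> integer_mod_group n} =
       {x + n * k | x k. x \<in> {0, 1, 2} \<and> k \<ge> 3} \<union> {1 + n, 1 + 2 * n}) \<and>
     (n \<in> {2, 3} \<longrightarrow>
       {card \<alpha> | \<alpha>. finite \<alpha> \<and> set_aut_group \<alpha> \<cong> integer_mod_group n} =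
       {x + n * k | x k. x \<in> {0, 1, 2} \<and> k \<ge> 3} \<union> {1 + 2 * n})"
proof -
  have n1: "n \<ge> 1" using assms by simp
  note iff = cyclic_index_realizable_iff[OF assms]
  have ex: "\<exists>\<alpha>. finite \<alpha> \<and> set_aut_group \<alpha> \<cong> integer_mod_group n \<and>
      has_cyclic_index n \<alpha> (\<nu>, k) \<and> card \<alpha> = m"
    if "realizable_index n \<nu> k" "m = \<nu> + n * k" for \<nu> k m
    using iff[of \<nu> k] that card_cyclic_index[OF n1] by blast
  have large: "\<forall>\<nu> \<in> {0, 1, 2}. \<forall>k \<ge> 3. \<exists>\<alpha>. finite \<alpha> \<and> set_aut_group \<alpha> \<cong> integer_mod_group n \<and>
      has_cyclic_index n \<alpha> (\<nu>, k) \<and> card \<alpha> = \<nu> + n * k"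
    by (intro ballI allI impI ex refl) (auto simp: realizable_index_def)
  have ex12: "\<exists>\<alpha>. finite \<alpha> \<and> set_aut_group \<alpha> \<cong> integer_mod_group n \<and>
      has_cyclic_index n \<alpha> (1, 2) \<and> card \<alpha> = 1 + 2 * n"
    by (rule ex) (auto simp: realizable_index_def)
  have ex11: "\<exists>\<alpha>. finite \<alpha> \<and> set_aut_group \<alpha> \<cong> integer_mod_group n \<and>
      has_cyclic_index n \<alpha> (1, 1) \<and> card \<alpha> = 1 + n" if "n \<ge> 4"
    by (rule ex) (use that in \<open>auto simp: realizable_index_def\<close>)
  have none: "\<not> (\<exists>\<alpha>. finite \<alpha> \<and> set_aut_group \<alpha> \<cong> integer_mod_group n \<and> has_cyclic_index n \<alpha> i)"
    if "\<not> realizable_index n (fst i) (snd i)" for i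
    using iff[of "fst i" "snd i"] that by simp
  have none_large: "\<forall>i \<in> {(0, 1), (0, 2), (2, 1), (2, 2)}.
      \<not> (\<exists>\<alpha>. finite \<alpha> \<and> set_aut_group \<alpha> \<cong> integer_mod_group n \<and> has_cyclic_index n \<alpha> i)"
    by (intro ballI none) (auto simp: realizable_index_def)
  have none_small: "\<forall>i \<in> {(0, 1), (0, 2), (1, 1), (2, 1), (2, 2)}.
      \<not> (\<exists>\<alpha>. finite \<alpha> \<and> set_aut_group \<alpha> \<cong> integer_mod_group n \<and> has_cyclic_index n \<alpha> i)" if "n \<in> {2, 3}"
    by (intro ballI none) (use that in \<open>auto simp: realizable_index_def\<close>)
  have sizes: "{\<nu> + n * k | \<nu> k. realizable_index n \<nu> k} =
      {x + n * k | x k. x \<in> {0, 1, 2} \<and> k \<ge> 3} \<union> {1 + 2 * n} \<union> (if n \<ge> 4 then {1 + n} else {})"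
    (is "?L = ?R")
  proof (intro equalityI subsetI)
    fix m assume "m \<in> ?L"
    then obtain \<nu> k where m: "m = \<nu> + n * k" "realizable_index n \<nu> k" by blast
    have "\<nu> \<le> 2 \<longleftrightarrow> \<nu> \<in> {0, 1, 2}" by auto
    then consider "\<nu> \<in> {0, 1, 2}" "k \<ge> 3" | "\<nu> = 1" "k = 2" | "\<nu> = 1" "k = 1" "n \<ge> 4"
      using m(2) unfolding realizable_index_def by blast
    then show "m \<in> ?R" using m(1) by cases (blast, auto)
  next
    fix m assume "m \<in> ?R"
    then consider x k where "m = x + n * k" "x \<in> {0, 1, 2}" "k \<ge> 3" | "m = 1 + n * 2" | "m = 1 + n * 1" "n \<ge> 4"
      by (auto split: if_split_asm)
    then show "m \<in> ?L"
      by cases (unfold mem_Collect_eq, (intro exI conjI, assumption, simp add: realizable_index_def; auto)+)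
  qed
  note cards = cardinalities_with_cyclic_group[OF assms, unfolded sizes]
  show ?thesis
    using large ex12 ex11 none_large none_small by (auto simp: cards simp del: One_nat_def)
qed

end
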